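(* Let $p\in\{3,5,7,11,13,19\}$ and $1\le\beta\le\frac{p-1}{2}$, and let $\beta^*\in[1,p-1]$ denote the inverse of $\beta$ modulo $p$. Let $v=v(p,\beta)$ be given by the following table (rows $p$, entries listed for $\beta=1,2,\dots,\frac{p-1}{2}$; an asterisk marks a "boldface" entry): $p=3$: $2^*$; $p=5$: $3^*,3^*$; $p=7$: $4^*,4^*,4^*$; $p=11$: $6^*,6^*,7^*,7^*,6$; $p=13$: $7^*,7^*,7,8^*,8^*,7$; $p=19$: $10^*,10^*,10,12^*,11,9,11^*,11,10$. Then $v\le M_\beta(p)\le m(\beta^* )$, and if the entry is marked with an asterisk then $M_\beta(p)=v$.
   Context: For a positive integer $n$, write the $n$-th cyclotomic polynomial as $\Phi_n(x)=\sum_{k=0}^{\varphi(n)}a_n(k)x^k$ and let its height be $A(n)=\max_k|a_n(k)|$. For an odd prime $p$ and a prime $q>p$, let $M(p;q)=\max\{A(pqr): r \text{ prime}, r>q\}$. For $1\le\beta\le p-1$, let $M_\beta(p)=\max\{M(p;q): q>p \text{ prime},\ q\equiv\beta \pmod p\}$ (this maximum exists). For the odd prime $p$ and $1\le j\le p-1$, define $w(j)=\frac{p-1}{2}+j$ if $j<\frac p4$; $w(j)=p-j$ if $\frac p4<j\le\frac{p-1}{2}$; $w(j)=w(p-j)$ if $j>\frac{p-1}{2}$; and $m(j)=\min\{w(j),\lfloor\frac{2}{3}p\rfloor\}$. *)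

theory Defs
  imports
    Complex_Main
    "HOL-Computational_Algebra.Polynomial"
    "HOL-Number_Theory.Cong"
    "HOL-Number_Theory.Totient"
begin

text \<open>
  The monic polynomial whose roots are the primitive \<open>n\<close>-th roots of unity. It has degree
  \<open>totient n\<close> and integer coefficients, but it is kept as a complex polynomial here,
  so the absolute value of a coefficient is its complex norm.
\<close>
definition cyclotomic :: "nat \<Rightarrow> complex poly" where
  "cyclotomic n = (\<Prod>k\<in>totatives n. [:- cis (2 * pi * real k / real n), 1:])"

definition height :: "nat \<Rightarrow> real" where
  "height n = Max ((\<lambda>k. norm (coeff (cyclotomic n) k)) ` {0..totient n})"

text \<open>
  The two maxima below range over infinitely many primes. They are written with
  \<^const>\<open>Greatest\<close>, which denotes the largest element attained; \<^const>\<open>Max\<close> is only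
  specified for finite sets.
\<close>
definition max_height :: "nat \<Rightarrow> nat \<Rightarrow> real" where
  "max_height p q = (GREATEST h. \<exists>r. prime r \<and> r > q \<and> h = height (p * q * r))"

definition max_height_class :: "nat \<Rightarrow> nat \<Rightarrow> real" where
  "max_height_class p \<beta> =
     (GREATEST h. \<exists>q. prime q \<and> q > p \<and> [q = \<beta>] (mod p) \<and> h = max_height p q)"

text \<open>
  The case \<open>j = p/4\<close> does not occur for odd \<open>p\<close>. The last clause of \<open>w\<close> is the reflection
  \<open>w j = w (p - j)\<close>, where \<open>p - j \<le> (p - 1)/2\<close> for odd \<open>p\<close>.
\<close>
definition w_low :: "nat \<Rightarrow> nat \<Rightarrow> nat" where
  "w_low p j = (if real j < real p / 4 then (p - 1) div 2 + j else p - j)"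

definition w :: "nat \<Rightarrow> nat \<Rightarrow> nat" where
  "w p j = (if j \<le> (p - 1) div 2 then w_low p j else w_low p (p - j))"

definition m :: "nat \<Rightarrow> nat \<Rightarrow> int" where
  "m p j = min (int (w p j)) \<lfloor>2 / 3 * real p\<rfloor>"

text \<open>
  Each row lists the entries for \<open>\<beta> = 1, 2, \<dots>, (p - 1)/2\<close>, so the entry for \<open>\<beta>\<close> has list
  index \<open>\<beta> - 1\<close>. The flag \<open>True\<close> marks a boldface entry.
\<close>
definition table :: "(nat \<times> (nat \<times> bool) list) list" where
  "table =
    [(3,  [(2, True)]),
     (5,  [(3, True), (3, True)]),
     (7,  [(4, True), (4, True), (4, True)]),
     (11, [(6, True), (6, True), (7, True), (7, True), (6, False)]),
     (13, [(7, True), (7, True), (7, False), (8, True), (8, True), (7, False)]),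
     (19, [(10, True), (10, True), (10, False), (12, True), (11, False), (9, False),
           (11, True), (11, False), (10, False)])]"

definition table_entry :: "nat \<Rightarrow> nat \<Rightarrow> nat \<times> bool" where
  "table_entry p \<beta> = the (map_of table p) ! (\<beta> - 1)"

definition v :: "nat \<Rightarrow> nat \<Rightarrow> nat" where
  "v p \<beta> = fst (table_entry p \<beta>)"

definition boldface :: "nat \<Rightarrow> nat \<Rightarrow> bool" where
  "boldface p \<beta> = snd (table_entry p \<beta>)"

end

theory Submission
  imports Defs
begin

text \<open>
  From \<open>(1 - x^{pq})(1 - x^{qr})(1 - x^{rp})(1 - x) \<Phi>_{pqr} = (1 - x^{pqr})(1 - x^p)(1 - x^q)(1 - x^r)\<close>, the
  \<open>n\<close>-th coefficient of \<open>\<Phi>_{pqr}\<close> is the sum of \<open>\<chi>(k) - \<chi>(k - q) - \<chi>(k - r) + \<chi>(k - q - r)\<close> over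
  \<open>n - p < k \<le> n\<close>, where \<open>\<chi>\<close> indicates the numbers \<open>a q r + b r p + c p q\<close> with \<open>a, b, c \<ge> 0\<close>.
  Replacing \<open>q, r\<close> by \<open>\<plusminus> q, \<plusminus> r\<close> shifts the window and changes at most the sign, so the inverses
  \<open>Q, R\<close> of \<open>q, r\<close> modulo \<open>p\<close> may be assumed to lie below \<open>p / 2\<close>. Writing each \<open>k\<close> with reduced digits
  \<open>a, b, c\<close> up to a multiple of \<open>p q r\<close>, the summand depends on \<open>a\<close>, that multiple, and two bits
  comparing \<open>b / q\<close> and \<open>c / r\<close> with thresholds near \<open>1 - Q / p\<close> and \<open>1 - R / p\<close>. With \<open>m = min Q R\<close> and
  \<open>M = max Q R\<close>, positive summands occur only for \<open>a < m\<close> and \<open>a \<ge> m + M\<close>, in the latter range only for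
  \<open>a\<close> in an interval of length \<open>m + M\<close>. This gives the bounds \<open>p - M\<close> and \<open>2 m + M\<close>, hence \<open>w\<close>.
  For the primes in question, \<open>2 p / 3\<close> is smaller than both in ten cases only, in which (almost)
  all candidates would have to be positive; since \<open>b / q\<close> and \<open>c / r\<close> move affinely with \<open>k\<close>, this
  forces negative summands, a contradiction. The lower bounds come from explicit coefficients.
\<close>

section \<open>Coefficients of ternary cyclotomic polynomials\<close>

lemma prod_unity_roots:
  assumes "n > 0"
  shows "(\<Prod>k\<in>{0<..n}. [:- cis (2 * pi * real k / real n), 1:]) = monom 1 n - 1"
proof (rule sym, rule poly_eqI_degree_lead_coeff)
  let ?A = "(\<lambda>k. cis (2 * pi * real k / real n)) ` {..<n}"
  let ?P = "\<Prod>k\<in>{0<..n}. [:- cis (2 * pi * real k / real n), 1:]"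
  have bij: "bij_betw (\<lambda>k. cis (2 * pi * real k / real n)) {..<n} {z. z ^ n = 1}"
    using bij_betw_roots_unity[OF assms] .
  have deg: "degree ?P = n"
    by (subst degree_prod_eq_sum_degree) auto
  show "degree ?P \<le> n" using deg by simp
  have "lead_coeff ?P = 1"
    by (simp add: lead_coeff_prod)
  then show "coeff (monom 1 n - 1) n = coeff ?P n"
    using deg assms by simp
  show "n \<le> card ?A"
    using bij_betw_same_card[OF bij] bij by (simp add: bij_betw_def)
  show "degree (monom 1 n - 1 :: complex poly) \<le> n"
    by (intro degree_diff_le) (auto simp: degree_monom_le)
  fix z assume "z \<in> ?A"
  then obtain k where k: "k < n" "z = cis (2 * pi * real k / real n)" by auto
  have "z ^ n = 1" using bij k by (auto simp: bij_betw_def)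
  \<comment> \<open>The product runs over \<open>{0<..n}\<close>, so the root for
    \<open>k = 0\<close> is the factor with index \<open>n\<close>.\<close>
  moreover have "\<exists>k\<in>{0<..n}. z = cis (2 * pi * real k / real n)"
  proof (cases "k = 0")
    case True
    then show ?thesis using k assms by (intro bexI[of _ n]) auto
  next
    case False
    then show ?thesis using k by (intro bexI[of _ k]) auto
  qed
  ultimately show "poly (monom 1 n - 1) z = poly ?P z"
    by (auto simp: poly_monom poly_prod)
qed

text \<open>Grouping the indices \<open>k\<close> by \<open>d = gcd k n\<close> turns each group
  into the primitive roots of order \<open>n div d\<close>.\<close>

lemma monom_minus_one_eq_prod_cyclotomic:
  assumes "n > 0"
  shows "monom 1 n - 1 = (\<Prod>d | d dvd n. cyclotomic d)"
proof -
  let ?f = "\<lambda>n k. [:- cis (2 * pi * real k / real n), 1:]"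
  have "monom 1 n - 1 = (\<Prod>k\<in>{0<..n}. ?f n k)"
    using prod_unity_roots[OF assms] by simp
  also have "\<dots> = (\<Prod>d | d dvd n. \<Prod>k\<in>{k\<in>{0<..n}. gcd k n = d}. ?f n k)"
    using assms by (subst prod.group) auto
  also have "\<dots> = (\<Prod>d | d dvd n. cyclotomic (n div d))"
  proof (rule prod.cong[OF refl])
    fix d assume "d \<in> {d. d dvd n}"
    then have d: "d dvd n" by simp
    then have "d > 0" using assms by (auto intro: Nat.gr0I)
    have "(\<Prod>k\<in>{k\<in>{0<..n}. gcd k n = d}. ?f n k) = (\<Prod>k\<in>totatives (n div d). ?f n (k * d))"
      using prod.reindex_bij_betw[OF bij_betw_totatives_gcd_eq[OF d assms], of "?f n"] by simp
    also have "\<dots> = cyclotomic (n div d)"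
      unfolding cyclotomic_def using d \<open>d > 0\<close>
      by (intro prod.cong refl) (auto simp: real_of_nat_div field_simps)
    finally show "(\<Prod>k\<in>{k\<in>{0<..n}. gcd k n = d}. ?f n k) = cyclotomic (n div d)" .
  qed
  also have "\<dots> = (\<Prod>d | d dvd n. cyclotomic d)"
    using assms
    by (intro prod.reindex_bij_witness[of _ "\<lambda>d. n div d" "\<lambda>d. n div d"])
       (auto elim!: dvdE)
  finally show ?thesis .
qed

lemma degree_cyclotomic: "degree (cyclotomic n) = totient n"
  unfolding cyclotomic_def totient_def
  by (subst degree_prod_eq_sum_degree) auto

lemma divisors_prime_mult:
  fixes p n :: nat
  assumes "prime p"
  shows "{d. d dvd p * n} = {d. d dvd n} \<union> (*) p ` {d. d dvd n}"
proof (intro equalityI subsetI)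
  fix d assume "d \<in> {d. d dvd p * n}"
  then have "d dvd p * n" by simp
  then obtain a b where "d = a * b" "a dvd p" "b dvd n"
    using division_decomp by blast
  then show "d \<in> {d. d dvd n} \<union> (*) p ` {d. d dvd n}"
    using assms by (auto simp: prime_nat_iff)
qed auto

lemma prod_divisors_prime_mult:
  fixes p n :: nat
  assumes "prime p" "\<not> p dvd n" "n > 0"
  shows "(\<Prod>d | d dvd p * n. f d) = (\<Prod>d | d dvd n. f d * f (p * d))"
proof -
  have inj: "inj_on ((*) p) {d. d dvd n}"
    using assms(1) by (auto simp: inj_on_def)
  have "{d. d dvd n} \<inter> (*) p ` {d. d dvd n} = {}"
    using assms(2) by (auto dest: dvd_mult_left)
  then show ?thesis
    unfolding divisors_prime_mult[OF assms(1)]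
    using assms(3) inj by (subst prod.union_disjoint) (auto simp: prod.reindex prod.distrib)
qed

text \<open>Written as products of \<open>cyclotomic d\<close>, both sides contain the fourth power
  for \<open>d = 1\<close>, the squares for the three primes, and one factor for each of the other
  divisors of \<open>p * q * r\<close>.\<close>

lemma cyclotomic_pqr_identity:
  fixes p q r :: nat
  defines "X \<equiv> (\<lambda>n. monom 1 n - 1 :: complex poly)"
  assumes "prime p" "prime q" "prime r" "p \<noteq> q" "p \<noteq> r" "q \<noteq> r"
  shows "cyclotomic (p * q * r) * (X 1 * X (p * q) * X (q * r) * X (r * p)) =
         X (p * q * r) * (X p * X q * X r)"
proof -
  have pos: "p > 0" "q > 0" "r > 0" using assms by (auto simp: prime_gt_0_nat)
  have nd: "\<not> p dvd q" "\<not> p dvd r" "\<not> q dvd r" "\<not> r dvd p"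
    using assms primes_dvd_imp_eq by blast+
  have nd2: "\<not> p dvd q * r" using nd assms by (simp add: prime_dvd_mult_iff)
  let ?c = cyclotomic
  note S = prod_divisors_prime_mult
  have X: "X n = (\<Prod>d | d dvd n. ?c d)" if "n > 0" for n
    using monom_minus_one_eq_prod_cyclotomic[OF that] by (simp add: X_def)
  have one: "{d::nat. d dvd 1} = {1}" by auto
  have e1: "X 1 = ?c 1" using X[of 1] by simp
  have single: "(\<Prod>d | d dvd s. f d) = f 1 * f s" if "prime s" for s :: nat and f :: "nat \<Rightarrow> complex poly"
    using S[OF that, of 1 f] that by (cases "s = 1") (auto simp: one)
  have double: "(\<Prod>d | d dvd s * t. f d) = f 1 * f s * (f t * f (s * t))"
    if "prime s" "prime t" "\<not> s dvd t" for s t :: nat and f :: "nat \<Rightarrow> complex poly"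
    using S[OF that(1,3), of f] single[OF that(2), of "\<lambda>d. f d * f (s * d)"] that prime_gt_0_nat by auto
  have e: "X p = ?c 1 * ?c p" "X q = ?c 1 * ?c q" "X r = ?c 1 * ?c r"
    using X pos single[of _ ?c] assms(2-4) by auto
  have e2: "X (p * q) = ?c 1 * ?c p * (?c q * ?c (p * q))"
    "X (q * r) = ?c 1 * ?c q * (?c r * ?c (q * r))"
    "X (r * p) = ?c 1 * ?c r * (?c p * ?c (r * p))"
    using X pos double[of _ _ ?c] assms nd by auto
  have "X (p * (q * r)) = (\<Prod>d | d dvd q * r. ?c d * ?c (p * d))"
    using S[OF assms(2) nd2, of ?c] X[of "p * (q * r)"] pos by simp
  also have "\<dots> = (?c 1 * ?c p) * (?c q * ?c (p * q)) * ((?c r * ?c (p * r)) * (?c (q * r) * ?c (p * (q * r))))"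
    using double[OF assms(3,4) nd(3), of "\<lambda>d. ?c d * ?c (p * d)"] by simp
  finally have e3: "X (p * q * r) = \<dots>" by (simp add: mult.assoc)
  show ?thesis
    unfolding e e1 e2 e3 by (simp add: mult_ac)
qed

section \<open>Ternary coefficients from representations\<close>

definition tri_sum :: "nat \<Rightarrow> nat \<Rightarrow> nat \<Rightarrow> complex poly" where
  "tri_sum p q r = (\<Sum>a<p. monom 1 (a * (q * r))) * (\<Sum>b<q. monom 1 (b * (r * p))) * (\<Sum>c<r. monom 1 (c * (p * q)))"

lemma sum_monom_geometric:
  "(monom 1 t - 1) * (\<Sum>a<s. monom 1 (a * t)) = (monom 1 (s * t) - 1 :: 'a :: comm_ring_1 poly)"
proof -
  have "(monom 1 t - 1) * (\<Sum>a<s. (monom 1 t) ^ a) = ((monom 1 t :: 'a poly) ^ s - 1)"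
    by (simp add: power_diff_1_eq)
  then show ?thesis by (simp add: monom_power mult.commute)
qed

text \<open>\<open>tri_sum\<close> is the product of the quotients of \<open>x^(pqr) - 1\<close> by
  \<open>x^(qr) - 1\<close>, \<open>x^(rp) - 1\<close> and \<open>x^(pq) - 1\<close>, so it clears
  the denominators of the identity. The square on the left is \<open>1\<close> modulo
  \<open>x^(pqr)\<close>, so coefficients below that degree can be read off the right side.\<close>

lemma cyclotomic_pqr_eq:
  fixes p q r :: nat
  assumes "prime p" "prime q" "prime r" "p \<noteq> q" "p \<noteq> r" "q \<noteq> r"
  shows "cyclotomic (p * q * r) * (monom 1 (p * q * r) - 1)\<^sup>2 =
         (\<Sum>i<p. monom 1 i) * (monom 1 q - 1) * (monom 1 r - 1) * tri_sum p q r"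
proof -
  let ?X = "\<lambda>n. monom 1 n - 1 :: complex poly"
  let ?c = "cyclotomic (p * q * r)"
  have pos: "p > 0" "q > 0" "r > 0" using assms by (auto simp: prime_gt_0_nat)
  have nz: "?X n \<noteq> 0" if "n > 0" for n
  proof
    assume "?X n = 0"
    then have "coeff (?X n) n = 0" by simp
    then show False using that by simp
  qed
  have g1: "?X (q * r) * (\<Sum>a<p. monom 1 (a * (q * r))) = ?X (p * q * r)"
    by (subst sum_monom_geometric) (simp add: mult_ac)
  have g2: "?X (r * p) * (\<Sum>a<q. monom 1 (a * (r * p))) = ?X (p * q * r)"
    by (subst sum_monom_geometric) (simp add: mult_ac)
  have g3: "?X (p * q) * (\<Sum>a<r. monom 1 (a * (p * q))) = ?X (p * q * r)"
    by (subst sum_monom_geometric) (simp add: mult_ac)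
  have g4: "?X 1 * (\<Sum>a<p. monom 1 a) = ?X p"
    using sum_monom_geometric[of 1 p] by simp
  let ?N = "?X (p * q * r)"
  \<comment> \<open>The extra factor \<open>?X 1 * ?N\<close> makes all four geometric sums
    applicable; it is cancelled at the end.\<close>
  have "(?c * ?N\<^sup>2) * (?X 1 * ?N) = ?c * (?X 1 * ?N * ?N * ?N)"
    by (simp add: power2_eq_square mult_ac)
  also have "\<dots> = ?c * (?X 1 * (?X (p * q) * (\<Sum>a<r. monom 1 (a * (p * q))))
       * (?X (q * r) * (\<Sum>a<p. monom 1 (a * (q * r)))) * (?X (r * p) * (\<Sum>a<q. monom 1 (a * (r * p)))))"
    by (simp only: g1 g2 g3)
  also have "\<dots> = ?c * (?X 1 * ?X (p * q) * ?X (q * r) * ?X (r * p)) * tri_sum p q r"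
    by (simp add: tri_sum_def mult_ac)
  also have "\<dots> = ?N * (?X p * ?X q * ?X r) * tri_sum p q r"
    using cyclotomic_pqr_identity[OF assms] by simp
  also have "\<dots> = ?N * ((?X 1 * (\<Sum>a<p. monom 1 a)) * ?X q * ?X r) * tri_sum p q r"
    by (simp only: g4)
  also have "\<dots> = ((\<Sum>i<p. monom 1 i) * ?X q * ?X r * tri_sum p q r) * (?X 1 * ?N)"
    by (simp add: mult_ac)
  finally show ?thesis
    using nz[of 1] nz[of "p * q * r"] pos by simp
qed

text \<open>Below \<open>p * q * r\<close> the upper bounds on the digits hold by themselves.
  \<open>k\<close> is an integer because shifts by \<open>q\<close> and \<open>r\<close> may make it
  negative.\<close>

definition represented :: "nat \<Rightarrow> nat \<Rightarrow> nat \<Rightarrow> int \<Rightarrow> bool" where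
  "represented p q r k \<longleftrightarrow> (\<exists>a b c. 0 \<le> a \<and> a < int p \<and> 0 \<le> b \<and> b < int q \<and> 0 \<le> c \<and> c < int r \<and>
     k = a * (int q * int r) + b * (int r * int p) + c * (int p * int q))"

lemma mult_cong_less_imp_eq:
  fixes a a' p u :: nat
  assumes "coprime p u" "[a * u = a' * u] (mod p)" "a < p" "a' < p"
  shows "a = a'"
  using assms by (metis cong_less_modulus_unique_nat cong_mult_rcancel_nat coprime_commute)

text \<open>Modulo \<open>p\<close>, \<open>q\<close> or \<open>r\<close> two of the three terms
  vanish, and the factor of the remaining digit is invertible.\<close>

lemma tri_rep_unique:
  fixes p q r :: nat
  assumes "coprime p q" "coprime p r" "coprime q r"
    and "a < p" "b < q" "c < r" "a' < p" "b' < q" "c' < r"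
    and eq: "a * (q * r) + b * (r * p) + c * (p * q) = a' * (q * r) + b' * (r * p) + c' * (p * q)"
  shows "a = a' \<and> b = b' \<and> c = c'"
proof (intro conjI)
  have "[a * (q * r) + b * (r * p) + c * (p * q) = a * (q * r)] (mod p)" for a b c :: nat
    unfolding cong_def by (metis (no_types) add.assoc mod_mult_self2 mult.assoc mult.commute distrib_left)
  then have "[a * (q * r) = a' * (q * r)] (mod p)"
    using eq by (metis cong_sym cong_trans)
  then show "a = a'" using assms by (intro mult_cong_less_imp_eq[of p "q * r"]) auto
  have "[a * (q * r) + b * (r * p) + c * (p * q) = b * (r * p)] (mod q)" for a b c :: nat
    unfolding cong_def by (metis (no_types) add.assoc add.commute mod_mult_self2 mult.assoc mult.commute distrib_left)
  then have "[b * (r * p) = b' * (r * p)] (mod q)"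
    using eq by (metis cong_sym cong_trans)
  then show "b = b'" using assms by (intro mult_cong_less_imp_eq[of q "r * p"]) (auto simp: coprime_commute)
  have "[a * (q * r) + b * (r * p) + c * (p * q) = c * (p * q)] (mod r)" for a b c :: nat
    unfolding cong_def by (metis (no_types) add.assoc add.commute mod_mult_self2 mult.assoc mult.commute distrib_left)
  then have "[c * (p * q) = c' * (p * q)] (mod r)"
    using eq by (metis cong_sym cong_trans)
  then show "c = c'" using assms by (intro mult_cong_less_imp_eq[of r "p * q"]) (auto simp: coprime_commute)
qed

lemma coeff_tri_sum:
  fixes p q r :: nat
  assumes "coprime p q" "coprime p r" "coprime q r"
  shows "coeff (tri_sum p q r) j = of_bool (represented p q r (int j))"
proof -
  let ?S = "({..<p} \<times> {..<q}) \<times> {..<r}"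
  let ?g = "\<lambda>((a, b), c). a * (q * r) + b * (r * p) + c * (p * q)"
  have "tri_sum p q r = (\<Sum>x\<in>?S. monom 1 (?g x))"
    unfolding tri_sum_def
    by (simp add: sum_product sum.cartesian_product mult_monom split_def)
  then have c: "coeff (tri_sum p q r) j = (\<Sum>x\<in>?S. of_bool (?g x = j))"
    by (simp add: coeff_sum of_bool_def)
  have rep: "represented p q r (int j) \<longleftrightarrow> (\<exists>x\<in>?S. ?g x = j)"
  proof
    assume "represented p q r (int j)"
    then obtain a b c where *: "0 \<le> a" "a < int p" "0 \<le> b" "b < int q" "0 \<le> c" "c < int r"
      "int j = a * (int q * int r) + b * (int r * int p) + c * (int p * int q)"
      unfolding represented_def by blast
    obtain a' b' c' where "a = int a'" "b = int b'" "c = int c'"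
      using * by (metis nonneg_int_cases)
    with * have "int (?g ((a', b'), c')) = int j" and "((a', b'), c') \<in> ?S"
      by auto
    then show "\<exists>x\<in>?S. ?g x = j" by (metis of_nat_eq_iff)
  next
    assume "\<exists>x\<in>?S. ?g x = j"
    then obtain a b c where "a < p" "b < q" "c < r" "?g ((a, b), c) = j" by blast
    then show "represented p q r (int j)"
      unfolding represented_def
      by (intro exI[of _ "int a"] exI[of _ "int b"] exI[of _ "int c"]) auto
  qed
  show ?thesis
  proof (cases "\<exists>x\<in>?S. ?g x = j")
    case True
    then obtain x where x: "x \<in> ?S" "?g x = j" by blast
    have uniq: "y = x" if "y \<in> ?S" "?g y = j" for y
    proof -
      obtain a b c a' b' c' where xy: "x = ((a, b), c)" "y = ((a', b'), c')"
        by (metis surj_pair)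
      show ?thesis
        using tri_rep_unique[OF assms, of a b c a' b' c'] x that unfolding xy by auto
    qed
    have "(\<Sum>y\<in>?S. of_bool (?g y = j)) = (\<Sum>y\<in>?S. if y = x then 1 else (0::complex))"
    proof (intro sum.cong refl)
      fix y assume y: "y \<in> ?S"
      show "of_bool (?g y = j) = (if y = x then 1 else (0::complex))"
      proof (cases "y = x")
        case True
        then show ?thesis using x(2) by (simp only: of_bool_eq if_True simp_thms)
      next
        case False
        then have "?g y \<noteq> j" using uniq[OF y] by metis
        then show ?thesis using False by (simp only: of_bool_eq if_False)
      qed
    qed
    then show ?thesis using c rep True x(1) by (simp add: sum.delta)
  next
    case False
    then have "(\<Sum>y\<in>?S. of_bool (?g y = j)) = (0::complex)"
      by (intro sum.neutral) auto
    with False c rep show ?thesis by simp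
  qed
qed

definition chi :: "nat \<Rightarrow> nat \<Rightarrow> nat \<Rightarrow> int \<Rightarrow> int" where
  "chi p q r k = of_bool (represented p q r k)"

lemma not_represented_neg: "k < 0 \<Longrightarrow> \<not> represented p q r k"
  unfolding represented_def by (metis add_nonneg_nonneg mult_nonneg_nonneg not_less of_nat_0_le_iff)

text \<open>The factor \<open>\<Sum>i<p. monom 1 i\<close> produces a window of length
  \<open>p\<close>, the factors for \<open>q\<close> and \<open>r\<close> the four shifts.\<close>

lemma coeff_cyclotomic_pqr:
  fixes p q r n :: nat
  assumes primes: "prime p" "prime q" "prime r" and ne: "p \<noteq> q" "p \<noteq> r" "q \<noteq> r"
    and n: "n < p * q * r"
  shows "coeff (cyclotomic (p * q * r)) n = of_int (\<Sum>i<p. let k = int n - int i in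
    chi p q r k - chi p q r (k - int q) - chi p q r (k - int r) + chi p q r (k - int q - int r))"
proof -
  have cop: "coprime p q" "coprime p r" "coprime q r"
    using primes ne by (auto simp: primes_coprime)
  have cm: "coeff (monom 1 j * P) m = (if m < j then 0 else coeff P (m - j))" for j m and P :: "complex poly"
    by (simp add: coeff_monom_mult)
  define E where "E = (\<lambda>k::int. of_int (chi p q r k) :: complex)"
  have E: "coeff (monom 1 j * tri_sum p q r) m = E (int m - int j)" for j m
    using cop not_represented_neg[of "int m - int j" p q r]
    by (auto simp: cm coeff_tri_sum E_def chi_def of_nat_diff of_bool_def)
  let ?N = "p * q * r"
  let ?c = "cyclotomic ?N"
  have "coeff ?c n = coeff (?c * (monom 1 ?N - 1)\<^sup>2) n"
  proof -
    have "?c * (monom 1 ?N - 1)\<^sup>2 = monom 1 ?N * (?c * (monom 1 ?N - 2)) + ?c"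
      by (simp add: power2_eq_square algebra_simps)
    then show ?thesis using n by (simp add: cm)
  qed
  also have "\<dots> = coeff ((\<Sum>i<p. monom 1 i) * (monom 1 q - 1) * (monom 1 r - 1) * tri_sum p q r) n"
    by (simp add: cyclotomic_pqr_eq[OF primes ne])
  also have "(\<Sum>i<p. monom 1 i) * (monom 1 q - 1) * (monom 1 r - 1) * tri_sum p q r =
    (\<Sum>i<p. monom 1 (i + q + r) * tri_sum p q r - monom 1 (i + q) * tri_sum p q r
      - monom 1 (i + r) * tri_sum p q r + monom 1 i * tri_sum p q r)"
  proof -
    have "monom 1 i * ((monom 1 q - 1) * (monom 1 r - 1) * tri_sum p q r) =
       monom 1 (i + q + r) * tri_sum p q r - monom 1 (i + q) * tri_sum p q r
      - monom 1 (i + r) * tri_sum p q r + monom 1 i * tri_sum p q r" for i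
    proof -
      have "monom 1 (i + q + r) = monom 1 i * monom 1 q * (monom 1 r :: complex poly)"
        "monom 1 (i + q) = monom 1 i * (monom 1 q :: complex poly)"
        "monom 1 (i + r) = monom 1 i * (monom 1 r :: complex poly)"
        by (simp_all add: mult_monom)
      then show ?thesis by (simp add: algebra_simps)
    qed
    then show ?thesis by (simp add: sum_distrib_right mult.assoc)
  qed
  also have "coeff \<dots> n = (\<Sum>i<p. let k = int n - int i in
      E (k - (int q + int r)) - E (k - int q) - E (k - int r) + E k)"
    by (simp only: coeff_sum coeff_add coeff_diff E Let_def of_nat_add diff_diff_eq add.assoc)
  also have "\<dots> = of_int (\<Sum>i<p. let k = int n - int i in
    chi p q r k - chi p q r (k - int q) - chi p q r (k - int r) + chi p q r (k - int q - int r))"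
    by (simp add: E_def Let_def algebra_simps)
  finally show ?thesis .
qed

section \<open>Bounds for the window sum\<close>

text \<open>
  An abstract window of \<open>p\<close> consecutive integers \<open>k\<close>, indexed by the residue \<open>a\<close> of \<open>k / (q r)\<close>
  modulo \<open>p\<close>. Up to small shifts, \<open>\<beta> a / p\<close> and \<open>\<gamma> a / p\<close> are the fractions \<open>b / q\<close> and \<open>c / r\<close>
  of the representation \<open>k = a q r + b r p + c p q - F p q r\<close>, and \<open>(d * a + e) mod p\<close> is the
  position of \<open>k\<close> in the window; \<open>Q\<close> and \<open>R\<close> are \<open>\<plusminus> 1 / q\<close> and \<open>\<plusminus> 1 / r\<close> modulo \<open>p\<close>. The shifts make
  \<open>\<beta>\<close> and \<open>\<gamma>\<close> exactly affine modulo \<open>p\<close> in the position, and the sum exactly \<open>N\<close> modulo \<open>p\<close>.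
\<close>
locale residue_model =
  fixes p Q R d e :: nat and N :: real and \<beta> \<gamma> :: "nat \<Rightarrow> real" and F :: "nat \<Rightarrow> int"
  assumes Q_less: "2 * Q < p" and R_less: "2 * R < p" and Q_pos: "0 < Q" and R_pos: "0 < R"
    and beta_bounds: "a < p \<Longrightarrow> 0 < \<beta> a \<and> \<beta> a < p"
    and gamma_bounds: "a < p \<Longrightarrow> 0 < \<gamma> a \<and> \<gamma> a < p"
    and total: "a < p \<Longrightarrow> a + \<beta> a + \<gamma> a = N + real p * of_int (F a)"
    and F_nonneg: "a < p \<Longrightarrow> 0 \<le> F a"
      "a < p \<Longrightarrow> 0 \<le> F a + of_bool (a < R) - of_bool (\<gamma> a \<ge> p - R)"
      "a < p \<Longrightarrow> 0 \<le> F a + of_bool (a < Q) - of_bool (\<beta> a \<ge> p - Q)"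
      "a < p \<Longrightarrow> 0 \<le> F a + of_bool (a < Q + R) - of_bool (\<beta> a \<ge> p - Q) - of_bool (\<gamma> a \<ge> p - R)"
    and beta_parallel: "\<lbrakk>a1 < p; a2 < p; a3 < p; a4 < p;
        (d * a1 + e) mod p + (d * a4 + e) mod p = (d * a2 + e) mod p + (d * a3 + e) mod p\<rbrakk>
        \<Longrightarrow> \<exists>z::int. \<beta> a1 + \<beta> a4 = \<beta> a2 + \<beta> a3 + real p * of_int z"
    and gamma_parallel: "\<lbrakk>a1 < p; a2 < p; a3 < p; a4 < p;
        (d * a1 + e) mod p + (d * a4 + e) mod p = (d * a2 + e) mod p + (d * a3 + e) mod p\<rbrakk>
        \<Longrightarrow> \<exists>z::int. \<gamma> a1 + \<gamma> a4 = \<gamma> a2 + \<gamma> a3 + real p * of_int z"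
begin

definition B :: "nat \<Rightarrow> bool" where "B a \<longleftrightarrow> \<beta> a \<ge> p - Q"
definition C :: "nat \<Rightarrow> bool" where "C a \<longleftrightarrow> \<gamma> a \<ge> p - R"
definition K :: "nat \<Rightarrow> nat" where "K a = (d * a + e) mod p"

text \<open>The four indicators belong to \<open>k\<close> and to \<open>k\<close> shifted by
  \<open>\<plusminus> q\<close>, by \<open>\<plusminus> r\<close> and by both; each asks whether the
  multiple of \<open>p q r\<close> in the digit expansion vanishes.\<close>

definition D :: "nat \<Rightarrow> int" where
  "D a = of_bool (F a = 0) - of_bool (F a + of_bool (a < R) - of_bool (C a) = 0)
     - of_bool (F a + of_bool (a < Q) - of_bool (B a) = 0)
     + of_bool (F a + of_bool (a < Q + R) - of_bool (B a) - of_bool (C a) = 0)"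

text \<open>The symmetry between \<open>q\<close> and \<open>r\<close>, which permits the assumption
  \<open>Q \<le> R\<close> below.\<close>

lemma swap: "residue_model p R Q d e N \<gamma> \<beta> F"
proof unfold_locales
  fix a assume "a < p"
  then show "a + \<gamma> a + \<beta> a = N + real p * of_int (F a)" using total[of a] by simp
  show "0 \<le> F a + of_bool (a < R + Q) - of_bool (\<gamma> a \<ge> p - R) - of_bool (\<beta> a \<ge> p - Q)"
    using F_nonneg(4)[OF \<open>a < p\<close>] by (simp add: add.commute)
qed (fact Q_less R_less Q_pos R_pos beta_bounds gamma_bounds F_nonneg beta_parallel gamma_parallel)+

lemma D_swap: "residue_model.D p R Q \<gamma> \<beta> F = D"
proof
  interpret s: residue_model p R Q d e N \<gamma> \<beta> F by (rule swap)
  show "s.D a = D a" for a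
    unfolding s.D_def D_def s.B_def s.C_def B_def C_def by (simp add: add.commute algebra_simps)
qed

lemma F_nonneg':
  assumes "a < p"
  shows "0 \<le> F a" "0 \<le> F a + of_bool (a < R) - of_bool (C a)"
    "0 \<le> F a + of_bool (a < Q) - of_bool (B a)"
    "0 \<le> F a + of_bool (a < Q + R) - of_bool (B a) - of_bool (C a)"
  using F_nonneg[OF assms] by (simp_all add: B_def C_def)

lemma D_le_1: "a < p \<Longrightarrow> D a \<le> 1"
  using F_nonneg'[of a] unfolding D_def by (auto simp: of_bool_def split: if_splits)

lemma D_ge_neg_1: "a < p \<Longrightarrow> -1 \<le> D a"
  using F_nonneg'[of a] unfolding D_def by (auto simp: of_bool_def split: if_splits)

lemma D_nonneg_high: "a < p \<Longrightarrow> Q + R \<le> a \<Longrightarrow> 0 \<le> D a"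
  using F_nonneg'[of a] unfolding D_def by (auto simp: of_bool_def split: if_splits)

lemma D_pos_high:
  assumes "a < p" "Q + R \<le> a" "0 < D a"
  shows "F a = 2" "B a" "C a"
  using assms F_nonneg'[of a] unfolding D_def by (auto simp: of_bool_def split: if_splits)

text \<open>With \<open>F a = 2\<close>, the sum of \<open>\<beta> a\<close> and
  \<open>\<gamma> a\<close> is \<open>N - a + 2 * p\<close>, and both values lie in top intervals of
  lengths \<open>Q\<close> and \<open>R\<close>. Hence \<open>a - N\<close> is confined to an
  interval of length \<open>Q + R\<close>.\<close>

lemma high_bounds:
  assumes "a < p" "Q + R \<le> a" "0 < D a"
  shows "p - Q \<le> \<beta> a" "p - R \<le> \<gamma> a" "a + \<beta> a + \<gamma> a = N + 2 * p" "0 < a - N" "a - N \<le> Q + R"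
  using D_pos_high[OF assms] total[OF assms(1)] beta_bounds[OF assms(1)] gamma_bounds[OF assms(1)]
    Q_less R_less
  by (auto simp: B_def C_def)

end

locale residue_model_le = residue_model +
  assumes Q_le_R: "Q \<le> R"
begin

lemma D_nonneg_low: "a < p \<Longrightarrow> a < Q \<Longrightarrow> 0 \<le> D a"
  using F_nonneg'[of a] Q_le_R unfolding D_def by (auto simp: of_bool_def split: if_splits)

lemma D_nonpos_mid: "a < p \<Longrightarrow> Q \<le> a \<Longrightarrow> a < Q + R \<Longrightarrow> D a \<le> 0"
  using F_nonneg'[of a] Q_le_R unfolding D_def by (auto simp: of_bool_def split: if_splits)

lemma D_pos_low:
  assumes "a < p" "a < Q" "0 < D a"
  shows "F a = 0 \<and> \<not> (B a \<and> C a) \<or> F a = 1 \<and> B a \<and> C a"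
  using assms F_nonneg'[of a] Q_le_R unfolding D_def by (auto simp: of_bool_def split: if_splits)

lemma D_neg_mid:
  assumes "a < p" "R \<le> a" "a < Q + R" "F a = 0 \<and> \<not> B a \<and> \<not> C a \<or> F a = 1 \<and> B a \<noteq> C a"
  shows "D a = -1"
  using assms F_nonneg'[of a] Q_le_R unfolding D_def by (auto simp: of_bool_def split: if_splits)

lemma sum_D_ge: "- int R \<le> (\<Sum>a<p. D a)"
proof -
  have sub: "{a \<in> {..<p}. Q \<le> a \<and> a < Q + R} = {Q..<Q + R}"
    using Q_less R_less by auto
  have "- int R = (\<Sum>a<p. - of_bool (Q \<le> a \<and> a < Q + R))"
    using sub by (simp add: sum_negf of_bool_def sum.If_cases Int_def)
  also have "\<dots> \<le> (\<Sum>a<p. D a)"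
    by (rule sum_mono) (use D_nonneg_low D_nonneg_high D_ge_neg_1 in \<open>force simp: not_le not_less\<close>)
  finally show ?thesis .
qed

text \<open>On the \<open>R\<close> residues \<open>Q..<Q + R\<close> no summand is positive, and
  elsewhere each is at most \<open>1\<close>.\<close>

lemma sum_D_le_diff: "(\<Sum>a<p. D a) \<le> int p - int R"
proof -
  have sub: "{a \<in> {..<p}. a < Q \<or> Q + R \<le> a} = {..<Q} \<union> {Q + R..<p}"
    using Q_less R_less by auto
  have "card ({..<Q} \<union> {Q + R..<p}) = Q + (p - (Q + R))"
    by (subst card_Un_disjoint) auto
  then have c: "int (card {a \<in> {..<p}. a < Q \<or> Q + R \<le> a}) = int p - int R"
    using sub Q_less R_less by simp
  have "(\<Sum>a<p. D a) \<le> (\<Sum>a<p. of_bool (a < Q \<or> Q + R \<le> a))"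
    by (rule sum_mono) (use D_nonpos_mid D_le_1 in \<open>force simp: not_le not_less\<close>)
  also have "\<dots> = int p - int R"
    using c by (simp add: of_bool_def sum.If_cases Int_def)
  finally show ?thesis .
qed

text \<open>There are \<open>Q\<close> low residues, and the interval from
  \<open>high_bounds\<close> holds at most \<open>Q + R\<close> integers.\<close>

lemma sum_D_le_lin: "(\<Sum>a<p. D a) \<le> 2 * int Q + int R"
proof -
  let ?T = "{a \<in> {..<p}. 0 < a - N \<and> a - N \<le> Q + R}"
  have fin: "finite ?T" by simp
  have "int ` ?T \<subseteq> {\<lfloor>N\<rfloor> + 1..\<lfloor>N\<rfloor> + int (Q + R)}"
  proof
    fix x assume "x \<in> int ` ?T"
    then obtain a where a: "x = int a" "0 < a - N" "a - N \<le> Q + R" by auto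
    then have "real_of_int x > N" "real_of_int x \<le> N + real (Q + R)" by auto
    then show "x \<in> {\<lfloor>N\<rfloor> + 1..\<lfloor>N\<rfloor> + int (Q + R)}"
      by (auto simp: floor_less_iff) linarith+
  qed
  then have "card (int ` ?T) \<le> card {\<lfloor>N\<rfloor> + 1..\<lfloor>N\<rfloor> + int (Q + R)}"
    by (intro card_mono) auto
  then have cT: "card ?T \<le> Q + R"
    by (simp add: card_image)
  have sub: "{a \<in> {..<p}. a < Q} = {..<Q}"
    using Q_less by auto
  have D_le: "D a \<le> of_bool (a < Q) + of_bool (a \<in> ?T)" if "a < p" for a
  proof -
    consider "a < Q" | "Q \<le> a" "a < Q + R" | "Q + R \<le> a" by linarith
    then show ?thesis
    proof cases
      case 1
      then show ?thesis using D_le_1[OF that] by simp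
    next
      case 2
      then show ?thesis using D_nonpos_mid[OF that] by simp
    next
      case 3
      show ?thesis
      proof (cases "0 < D a")
        case True
        then show ?thesis using high_bounds(4,5)[OF that 3 True] D_le_1[OF that] that by simp
      qed simp
    qed
  qed
  have "(\<Sum>a<p. D a) \<le> (\<Sum>a<p. of_bool (a < Q) + of_bool (a \<in> ?T))"
    by (rule sum_mono) (use D_le in simp)
  also have "\<dots> = int (card {a \<in> {..<p}. a < Q}) + int (card ({..<p} \<inter> ?T))"
    by (simp add: sum.distrib of_bool_def sum.If_cases Int_def)
  also have "{..<p} \<inter> ?T = ?T" by blast
  finally show ?thesis using cT sub by simp
qed

section \<open>Parallelograms of residues and sums close to the bound \<open>p - R\<close>\<close>

text \<open>
  Going from \<open>a1\<close> to \<open>a2\<close> changes \<open>\<beta>\<close> and \<open>\<gamma>\<close> by the same amounts as going from \<open>y\<close> to \<open>y'\<close>. If all of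
  \<open>a1, y, y'\<close> contribute \<open>1\<close>, this pins down \<open>a2\<close> well enough to force the contribution \<open>-1\<close>.
\<close>
lemma parallelogram:
  assumes a1: "a1 < Q" and a2: "R \<le> a2" "a2 < Q + R" and y: "Q + R \<le> y" and y': "y' < p"
    and g: "y' + a1 = y + a2" and K: "K a1 + K y' = K a2 + K y"
    and N: "N + Q + R < a1 + p" "N + R \<le> a1 + p" "a2 \<le> N" "N + Q + R \<le> p + a2"
  shows "D a1 + D y + D y' + D a2 \<le> 2"
proof -
  have lt: "a1 < p" "a2 < p" "y < p" "Q \<le> a2" "Q + R \<le> y'" "a1 < Q"
    using assms Q_le_R Q_less R_less by auto
  have le: "D a1 \<le> 1" "D y \<le> 1" "D y' \<le> 1" "D a2 \<le> 0"
    using D_le_1 D_nonpos_mid lt a2 y' by auto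
  show ?thesis
  proof (cases "0 < D a1 \<and> 0 < D y \<and> 0 < D y'")
    case True
    have y_b: "p - Q \<le> \<beta> y" "p - R \<le> \<gamma> y" "y + \<beta> y + \<gamma> y = N + 2 * p"
      using high_bounds[of y] lt y True by auto
    have y'_b: "p - Q \<le> \<beta> y'" "p - R \<le> \<gamma> y'" "y' + \<beta> y' + \<gamma> y' = N + 2 * p"
      using high_bounds[of y'] lt y' True by auto
    have up: "\<beta> y < p" "\<gamma> y < p" "\<beta> y' < p" "\<gamma> y' < p"
      using beta_bounds gamma_bounds lt y' by auto
    have b1: "0 < \<beta> a1" "0 < \<gamma> a1" "0 < \<beta> a2" "0 < \<gamma> a2" "\<beta> a2 < p" "\<gamma> a2 < p"
      using beta_bounds gamma_bounds lt by auto
    have "F a1 = 0 \<and> \<not> (B a1 \<and> C a1) \<or> F a1 = 1 \<and> B a1 \<and> C a1"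
      using D_pos_low lt True by blast
    \<comment> \<open>Here \<open>\<beta> a1 + \<gamma> a1\<close> would be at least
      \<open>2 * p - Q - R\<close>, which the first bound on \<open>N\<close> forbids.\<close>
    moreover have False if "F a1 = 1" "B a1" "C a1"
      using total[OF lt(1)] that N(1) Q_less R_less by (simp add: B_def C_def)
    ultimately have F1: "F a1 = 0" by blast
    have s1: "a1 + \<beta> a1 + \<gamma> a1 = N"
      using total[OF lt(1)] F1 by simp
    obtain z where z: "\<beta> a1 + \<beta> y' = \<beta> a2 + \<beta> y + p * of_int z"
      using beta_parallel[of a1 a2 y y'] K lt y' unfolding K_def by auto
    obtain z' where z': "\<gamma> a1 + \<gamma> y' = \<gamma> a2 + \<gamma> y + p * of_int z'"
      using gamma_parallel[of a1 a2 y y'] K lt y' unfolding K_def by auto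
    \<comment> \<open>\<open>x\<close> and \<open>w\<close> are the values predicted for
      \<open>\<beta> a2\<close> and \<open>\<gamma> a2\<close> before reduction modulo
      \<open>p\<close>.\<close>
    define x where "x = \<beta> a1 + \<beta> y' - \<beta> y"
    define w where "w = \<gamma> a1 + \<gamma> y' - \<gamma> y"
    have gr: "real y' + real a1 = real y + real a2"
      using g by (metis of_nat_add)
    have xw: "x + w = N - a2"
      unfolding x_def w_def using s1 y_b(3) y'_b(3) gr by linarith
    have x: "- real Q < x" "x < real p - real Q"
      unfolding x_def using b1 y_b y'_b up Q_less R_less xw N(4) unfolding x_def w_def by linarith+
    have w: "- real R < w" "w < real p - real R"
      unfolding w_def using b1 y_b y'_b up Q_less R_less xw N(4) unfolding x_def w_def by linarith+
    have bx: "\<beta> a2 = x - p * of_int z" "\<gamma> a2 = w - p * of_int z'"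
      using z z' by (simp_all add: x_def w_def)
    have *: "(0 < t \<and> k = 0) \<or> (t \<le> 0 \<and> k = -1)"
      if "- real p < t" "t < real p" "0 < t - real p * of_int k" "t - real p * of_int k < real p"
      for t and k :: int
    proof -
      have "real p * of_int k < real p * of_int 1" "real p * of_int (-2) < real p * of_int k"
        using that by (simp_all only: of_int_1 of_int_minus of_int_numeral)
      then have "k < 1" "-2 < k"
        using Q_less by (simp_all only: mult_less_cancel_left_pos of_int_less_iff of_nat_0_less_iff)
      then have "k = 0 \<or> k = -1" by linarith
      then show ?thesis using that by auto
    qed
    \<comment> \<open>A positive prediction is below \<open>p - Q\<close> and is the actual value,
      so the bit stays unset. A nonpositive one exceeds \<open>- Q\<close>, wraps around once and
      sets the bit. The same holds for \<open>w\<close> and \<open>R\<close>.\<close>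
    have zx: "(0 < x \<and> z = 0) \<or> (x \<le> 0 \<and> z = -1)"
      using x b1 Q_less bx by (intro *) auto
    have zw: "(0 < w \<and> z' = 0) \<or> (w \<le> 0 \<and> z' = -1)"
      using w b1 R_less bx by (intro *) auto
    have tot: "a2 + \<beta> a2 + \<gamma> a2 = N + p * F a2"
      using total lt by simp
    have "N + p * real_of_int (F a2) = N - p * of_int z - p * of_int z'"
      using tot bx xw by simp
    then have "real p * real_of_int (F a2) = real p * real_of_int (- z - z')"
      by (simp add: algebra_simps)
    \<comment> \<open>\<open>F a2\<close> counts the wraps.\<close>
    then have Fz: "F a2 = - z - z'"
      using Q_less by (simp only: mult_cancel_left of_int_eq_iff) auto
    have xw_nonneg: "0 \<le> x + w" using xw N(3) by simp
    have "F a2 = 0 \<and> \<not> B a2 \<and> \<not> C a2 \<or> F a2 = 1 \<and> B a2 \<noteq> C a2"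
      using zx zw
    proof (elim disjE conjE)
      assume "0 < x" "z = 0" "0 < w" "z' = 0"
      then show ?thesis using Fz bx x w Q_less R_less by (simp add: B_def C_def)
    next
      assume "0 < x" "z = 0" "w \<le> 0" "z' = -1"
      then show ?thesis using Fz bx x w Q_less R_less by (simp add: B_def C_def)
    next
      assume "x \<le> 0" "z = -1" "0 < w" "z' = 0"
      then show ?thesis using Fz bx x w Q_less R_less by (simp add: B_def C_def)
    next
      \<comment> \<open>Two wraps would need \<open>x = w = 0\<close>, hence
        \<open>\<beta> a2 = p\<close>.\<close>
      assume h: "x \<le> 0" "z = -1" "w \<le> 0" "z' = -1"
      then have "x = 0" using xw_nonneg by simp
      then show ?thesis using bx(1) b1(5) h by simp
    qed
    then have "D a2 = -1" using D_neg_mid lt a2 by blast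
    then show ?thesis using le by linarith
  qed (use le in linarith)
qed

text \<open>The amount by which \<open>D a\<close> misses the bound behind
  \<open>sum_D_le_diff\<close>. All defects add up to \<open>p - R\<close> minus the sum of
  \<open>D\<close>, so a large sum allows only few of them.\<close>

definition defect :: "nat \<Rightarrow> int" where
  "defect a = of_bool (a < Q \<or> Q + R \<le> a) - D a"

lemma defect_nonneg: "a < p \<Longrightarrow> 0 \<le> defect a"
  using D_nonpos_mid[of a] D_le_1[of a] unfolding defect_def by (auto simp: not_le not_less)

lemma sum_defect_subset:
  assumes "T \<subseteq> {..<p}"
  shows "(\<Sum>a\<in>T. defect a) \<le> int p - int R - (\<Sum>a<p. D a)"
proof -
  have "{a \<in> {..<p}. a < Q \<or> Q + R \<le> a} = {..<Q} \<union> {Q + R..<p}"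
    using Q_less R_less by auto
  moreover have "card ({..<Q} \<union> {Q + R..<p}) = Q + (p - (Q + R))"
    by (subst card_Un_disjoint) auto
  ultimately have c: "int (card {a \<in> {..<p}. a < Q \<or> Q + R \<le> a}) = int p - int R"
    using Q_less R_less by simp
  have "(\<Sum>a\<in>T. defect a) \<le> (\<Sum>a<p. defect a)"
    using assms defect_nonneg by (intro sum_mono2) auto
  also have "\<dots> = int p - int R - (\<Sum>a<p. D a)"
    unfolding defect_def using c by (simp add: sum_subtractf of_bool_def sum.If_cases Int_def)
  finally show ?thesis .
qed

lemma parallelogram_defect:
  assumes "a1 < Q" "R \<le> a2" "a2 < Q + R" "Q + R \<le> y" "y' < p"
    "y' + a1 = y + a2" "K a1 + K y' = K a2 + K y"
    "N + Q + R < a1 + p" "N + R \<le> a1 + p" "a2 \<le> N" "N + Q + R \<le> p + a2"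
  shows "1 \<le> defect a1 + defect y + defect y' + defect a2"
  using parallelogram[OF assms] assms Q_le_R by (simp add: defect_def)

lemma N_ge: "a < p \<Longrightarrow> Q + R \<le> a \<Longrightarrow> defect a = 0 \<Longrightarrow> a \<le> N + Q + R"
  and N_less: "a < p \<Longrightarrow> Q + R \<le> a \<Longrightarrow> defect a = 0 \<Longrightarrow> N < a"
  using high_bounds(4,5)[of a] by (auto simp: defect_def)

text \<open>A sum of \<open>p - R\<close> leaves no defect. The candidates \<open>Q + R\<close> and
  \<open>p - 1\<close> then locate \<open>N\<close>, and a parallelogram with corners
  \<open>Q - 1\<close> and \<open>R\<close> would create a defect.\<close>

lemma tight_contradiction:
  assumes S: "int p - int R \<le> (\<Sum>a<p. D a)"
    and size: "2 * (Q + R) < Q + p" "2 * R + Q < p"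
    and y: "Q + R \<le> y" "y + (R + 1 - Q) < p"
    and K: "K (Q - 1) + K (y + (R + 1 - Q)) = K R + K y"
  shows False
proof -
  have zero: "defect a = 0" if "a < p" for a
    using sum_defect_subset[of "{a}"] defect_nonneg[OF that] S that by simp
  have "N < real (Q + R)" "real (p - 1) \<le> N + Q + R"
    using N_less[of "Q + R"] N_ge[of "p - 1"] zero size Q_pos by auto
  then have "1 \<le> defect (Q - 1) + defect y + defect (y + (R + 1 - Q)) + defect R"
    using assms Q_pos R_pos Q_le_R R_less
    by (intro parallelogram_defect) (auto simp: of_nat_diff)
  then show False using zero y Q_less R_less by simp
qed

text \<open>When \<open>p = 2 * (Q + R) + 1\<close>, the candidates \<open>Q + R\<close> and \<open>p - 1\<close> exclude each other.\<close>

lemma near_tight: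
  assumes S: "int p - int R - 1 \<le> (\<Sum>a<p. D a)" and p: "p = 2 * (Q + R) + 1"
  shows "\<And>a. a < p \<Longrightarrow> a \<noteq> Q + R \<Longrightarrow> a \<noteq> p - 1 \<Longrightarrow> defect a = 0"
    and "defect (Q + R) = 0 \<or> defect (p - 1) = 0"
proof -
  have "\<not> (defect (Q + R) = 0 \<and> defect (p - 1) = 0)"
    using N_less[of "Q + R"] N_ge[of "p - 1"] p by auto
  then have one: "1 \<le> defect (Q + R) + defect (p - 1)"
    using defect_nonneg[of "Q + R"] defect_nonneg[of "p - 1"] p by force
  have sum2: "defect (Q + R) + defect (p - 1) \<le> 1"
    using sum_defect_subset[of "{Q + R, p - 1}"] S p Q_pos by simp
  show "defect (Q + R) = 0 \<or> defect (p - 1) = 0"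
    using defect_nonneg[of "Q + R"] defect_nonneg[of "p - 1"] sum2 p by force
  fix a assume a: "a < p" "a \<noteq> Q + R" "a \<noteq> p - 1"
  then show "defect a = 0"
    using sum_defect_subset[of "{a, Q + R, p - 1}"] defect_nonneg[OF a(1)] one S p Q_pos by simp
qed

text \<open>The single allowed defect sits at \<open>Q + R\<close> or \<open>p - 1\<close>. The
  hypothesis on \<open>K\<close> offers either a parallelogram avoiding both residues or one through
  each; in the latter case the one through the residue without defect is used.\<close>

lemma near_tight_contradiction:
  assumes S: "int p - int R - 1 \<le> (\<Sum>a<p. D a)" and p: "p = 2 * (Q + R) + 1"
    and K: "(\<exists>y. Q + R < y \<and> y + (R + 1 - Q) < p - 1 \<and> K (Q - 1) + K (y + (R + 1 - Q)) = K R + K y)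
      \<or> (\<forall>y. y = Q + R \<or> y + (R + 1 - Q) = p - 1 \<longrightarrow> K (Q - 1) + K (y + (R + 1 - Q)) = K R + K y)"
  shows False
proof -
  have size: "R + 1 < 2 * Q + R" using Q_pos by simp
  note z = near_tight[OF S p]
  have N: "N < real (Q + R + 1)" "real (p - 2) \<le> N + Q + R"
    using N_less[of "Q + R + 1"] N_ge[of "p - 2"] z(1)[of "Q + R + 1"] z(1)[of "p - 2"] p Q_pos R_pos size by auto
  have par: "1 \<le> defect (Q - 1) + defect y + defect (y + (R + 1 - Q)) + defect R"
    if "Q + R \<le> y" "y + (R + 1 - Q) < p" "K (Q - 1) + K (y + (R + 1 - Q)) = K R + K y" for y
    using that Q_pos R_pos Q_le_R R_less p N
    by (intro parallelogram_defect) (auto simp: of_nat_diff)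
  have low: "defect (Q - 1) = 0" "defect R = 0"
    using z(1)[of "Q - 1"] z(1)[of R] p Q_pos by auto
  show False
    using K
  proof
    assume "\<exists>y. Q + R < y \<and> y + (R + 1 - Q) < p - 1 \<and> K (Q - 1) + K (y + (R + 1 - Q)) = K R + K y"
    then obtain y where y: "Q + R < y" "y + (R + 1 - Q) < p - 1"
      and K: "K (Q - 1) + K (y + (R + 1 - Q)) = K R + K y"
      by blast
    have "y < p - 1" "y < p" "y + (R + 1 - Q) < p" "y + (R + 1 - Q) \<noteq> Q + R"
      using y by auto
    then show False using par[OF _ _ K] low z(1)[of y] z(1)[of "y + (R + 1 - Q)"] y by simp
  next
    assume *: "\<forall>y. y = Q + R \<or> y + (R + 1 - Q) = p - 1 \<longrightarrow> K (Q - 1) + K (y + (R + 1 - Q)) = K R + K y"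
    show False
      using z(2)
    proof
      assume "defect (Q + R) = 0"
      then show False
        using par[of "Q + R"] * low z(1)[of "Q + R + (R + 1 - Q)"] Q_le_R p Q_pos size by auto
    next
      assume d: "defect (p - 1) = 0"
      define y where "y = p - 1 - (R + 1 - Q)"
      have y: "y + (R + 1 - Q) = p - 1" "Q + R < y" "y < p - 1"
        using p Q_le_R size Q_pos unfolding y_def by auto
      then show False
        using par[of y] * low z(1)[of y] d p by auto
    qed
  qed
qed

text \<open>Along equally spaced positions the second differences of \<open>\<beta>\<close> are
  multiples of \<open>p\<close>. High residues with positive summand keep \<open>\<beta>\<close> in
  an interval of length \<open>Q\<close>, less than \<open>p / 2\<close>, so these multiples are
  zero.\<close>

lemma beta_run:
  assumes run: "\<And>j. j \<le> t \<Longrightarrow> y + j < p \<and> Q + R \<le> y + j \<and> 0 < D (y + j)"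
    and K: "\<And>j. j + 2 \<le> t \<Longrightarrow> K (y + j) + K (y + j + 2) = 2 * K (y + j + 1)"
    and j: "j \<le> t"
  shows "\<beta> (y + j) = \<beta> y + j * (\<beta> (y + 1) - \<beta> y)"
proof -
  have b: "p - real Q \<le> \<beta> (y + j)" "\<beta> (y + j) < p" if "j \<le> t" for j
    using run[OF that] high_bounds(1)[of "y + j"] beta_bounds[of "y + j"] Q_less by auto
  have step: "\<beta> (y + j + 2) + \<beta> (y + j) = 2 * \<beta> (y + j + 1)" if jt: "j + 2 \<le> t" for j
  proof -
    obtain z where z: "\<beta> (y + j) + \<beta> (y + j + 2) = \<beta> (y + j + 1) + \<beta> (y + j + 1) + real p * of_int z"
      using beta_parallel[of "y + j" "y + j + 1" "y + j + 1" "y + j + 2"] K[OF jt] jt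
        run[of j] run[of "j + 1"] run[of "j + 2"]
      unfolding K_def by (auto simp: algebra_simps)
    have "p - real Q \<le> \<beta> (y + j)" "\<beta> (y + j) < p" "p - real Q \<le> \<beta> (y + j + 1)" "\<beta> (y + j + 1) < p"
      "p - real Q \<le> \<beta> (y + j + 2)" "\<beta> (y + j + 2) < p" "2 * real Q < p"
      using b[of j] b[of "j + 1"] b[of "j + 2"] jt Q_less by (auto simp: add.assoc)
    then have "real p * of_int z < real p * 1" "real p * (-1) < real p * of_int z"
      using z by linarith+
    then have "real p * of_int z < real p * of_int 1" "real p * of_int (-1) < real p * of_int z"
      by simp_all
    then have "z < 1" "-1 < z"
      using Q_less by (simp_all only: mult_less_cancel_left_pos of_int_less_iff of_nat_0_less_iff)
    then have "z = 0" by simp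
    then show ?thesis using z by simp
  qed
  show ?thesis using j
  proof (induction j rule: less_induct)
    case (less j)
    consider "j = 0" | "j = 1" | i where "j = i + 2" by (metis One_nat_def Suc_1 add_2_eq_Suc' not0_implies_Suc)
    then show ?case
    proof cases
      case 3
      then show ?thesis
        using step[of i] less.IH[of i] less.IH[of "i + 1"] less.prems by (simp add: algebra_simps)
    qed auto
  qed
qed

text \<open>
  If the positions \<open>K\<close> proceed regularly along a run at the top of the range and across
  \<open>p - 1, 0\<close>, then \<open>\<beta>\<close> continues linearly and is too large at a low residue \<open>a\<close>.
\<close>

lemma run_contradiction:
  assumes run: "\<And>j. j \<le> t \<Longrightarrow> y + j < p \<and> Q + R \<le> y + j \<and> 0 < D (y + j)"
    and K: "\<And>j. j + 2 \<le> t \<Longrightarrow> K (y + j) + K (y + j + 2) = 2 * K (y + j + 1)"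
    and g: "g \<le> t" "R \<le> t" "0 < t" "K a + K y = K (y + t) + K (y + g)"
    and a: "a < Q" "0 < D a"
    and N: "N + Q + R < a + p" "N + 2 * Q \<le> a + p"
  shows False
proof -
  define h where "h = \<beta> (y + 1) - \<beta> y"
  have ap: "a < p" using a Q_less by simp
  have lin: "\<beta> (y + j) = \<beta> y + j * h" if "j \<le> t" for j
    using beta_run[OF run K that] unfolding h_def by simp
  have r0: "y < p" "Q + R \<le> y" "0 < D y" and rt: "y + t < p" "Q + R \<le> y + t" "0 < D (y + t)"
    and rg: "y + g < p"
    using run[of 0] run[of t] run[of g] g by auto
  have th: "\<beta> (y + t) = \<beta> y + t * h" and gh: "\<beta> (y + g) = \<beta> y + g * h"
    using lin[of t] lin[of g] g by auto
  note bnd = high_bounds[OF r0] high_bounds[OF rt] beta_bounds[OF r0(1)] beta_bounds[OF rt(1)]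
    gamma_bounds[OF r0(1)] gamma_bounds[OF rt(1)]
  \<comment> \<open>Along the run \<open>\<beta> + \<gamma>\<close> falls by \<open>t\<close> while
    \<open>\<gamma>\<close> falls by less than \<open>R\<close>, and \<open>R \<le> t\<close>; so
    \<open>\<beta>\<close> falls.\<close>
  have "t * h < real R - t" "- real Q < t * h"
    using bnd th Q_less R_less by auto
  then have t_h: "t * h < 0" "- real Q < t * h" using g by auto
  then have h0: "h < 0" using g by (simp add: mult_less_0_iff)
  have g_h: "t * h \<le> g * h" "g * h \<le> 0"
    using g h0 by (auto simp: mult_le_0_iff intro: mult_right_mono_neg)
  obtain z where z: "\<beta> a + \<beta> y = \<beta> (y + t) + \<beta> (y + g) + real p * of_int z"
    using beta_parallel[of a "y + t" "y + g" y] g ap r0 rt rg unfolding K_def by auto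
  have ba: "\<beta> a = \<beta> (y + t) + g * h + real p * of_int z" using z gh by simp
  have "real p * of_int z < real p * 1" "real p * (-1) < real p * of_int z"
  proof -
    have "2 * real Q < p" "p - real Q \<le> \<beta> (y + t)" "\<beta> (y + t) < p" "0 < \<beta> a" "\<beta> a < p"
      using bnd beta_bounds[OF ap] Q_less by auto
    then show "real p * of_int z < real p * 1" "real p * (-1) < real p * of_int z"
      using ba g_h t_h by linarith+
  qed
  then have "real p * of_int z < real p * of_int 1" "real p * of_int (-1) < real p * of_int z"
    by simp_all
  then have "z < 1" "-1 < z"
    using Q_less by (simp_all only: mult_less_cancel_left_pos of_int_less_iff of_nat_0_less_iff)
  then have "z = 0" by simp
  \<comment> \<open>\<open>\<beta> (y + t)\<close> is at least \<open>p - Q\<close>, and the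
    extrapolation loses less than another \<open>Q\<close>.\<close>
  then have big: "p - 2 * real Q < \<beta> a" using ba bnd g_h t_h by simp
  have "F a = 0 \<and> \<not> (B a \<and> C a) \<or> F a = 1 \<and> B a \<and> C a"
    using D_pos_low ap a by blast
  moreover have False if "F a = 1" "B a" "C a"
    using total[OF ap] that N(1) Q_less R_less by (simp add: B_def C_def)
  ultimately have "a + \<beta> a + \<gamma> a = N"
    using total[OF ap] by auto
  then show False using big N(2) gamma_bounds[OF ap] by simp
qed

end

section \<open>The bound \<open>2 p / 3\<close>\<close>

text \<open>
  The finite searches below provide the parallelograms; the conditions on \<open>d\<close> say \<open>d Q R = \<plusminus> 1\<close>
  modulo \<open>p\<close>, and the exceptional pairs \<open>(d, e)\<close> are those left to the run argument above.
\<close>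

lemma steps_7_2_2:
  "\<forall>d\<in>{0..<7}. (d * 4) mod 7 \<in> {1, 6} \<longrightarrow> (\<forall>e\<in>{0..<7}.
     (\<exists>y\<in>{4..<6}. (d * 1 + e) mod 7 + (d * (y + 1) + e) mod 7 = (d * 2 + e) mod 7 + (d * y + e) mod (7::nat)))"
  unfolding atLeastLessThan_upt by code_simp

lemma steps_11_3_3:
  "\<forall>d\<in>{0..<11}. (d * 9) mod 11 \<in> {1, 10} \<longrightarrow> (\<forall>e\<in>{0..<11}.
     (\<exists>y\<in>{6..<10}. (d * 2 + e) mod 11 + (d * (y + 1) + e) mod 11 = (d * 3 + e) mod 11 + (d * y + e) mod (11::nat)))"
  unfolding atLeastLessThan_upt by code_simp

lemma steps_13_3_4:
  "\<forall>d\<in>{0..<13}. (d * 12) mod 13 \<in> {1, 12} \<longrightarrow> (\<forall>e\<in>{0..<13}.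
     (\<exists>y\<in>{7..<11}. (d * 2 + e) mod 13 + (d * (y + 2) + e) mod 13 = (d * 4 + e) mod 13 + (d * y + e) mod (13::nat)) \<or> d = 12 \<and> e \<in> {2, 3} \<or> d = 1 \<and> e \<in> {9, 10})"
  unfolding atLeastLessThan_upt by code_simp

lemma steps_13_4_4:
  "\<forall>d\<in>{0..<13}. (d * 16) mod 13 \<in> {1, 12} \<longrightarrow> (\<forall>e\<in>{0..<13}.
     (\<exists>y\<in>{8..<12}. (d * 3 + e) mod 13 + (d * (y + 1) + e) mod 13 = (d * 4 + e) mod 13 + (d * y + e) mod (13::nat)))"
  unfolding atLeastLessThan_upt by code_simp

lemma steps_19_4_6:
  "\<forall>d\<in>{0..<19}. (d * 24) mod 19 \<in> {1, 18} \<longrightarrow> (\<forall>e\<in>{0..<19}.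
     (\<exists>y\<in>{10..<16}. (d * 3 + e) mod 19 + (d * (y + 3) + e) mod 19 = (d * 6 + e) mod 19 + (d * y + e) mod (19::nat)))"
  unfolding atLeastLessThan_upt by code_simp

lemma steps_19_5_6:
  "\<forall>d\<in>{0..<19}. (d * 30) mod 19 \<in> {1, 18} \<longrightarrow> (\<forall>e\<in>{0..<19}.
     (\<exists>y\<in>{11..<17}. (d * 4 + e) mod 19 + (d * (y + 2) + e) mod 19 = (d * 6 + e) mod 19 + (d * y + e) mod (19::nat)))"
  unfolding atLeastLessThan_upt by code_simp

lemma steps_19_6_6:
  "\<forall>d\<in>{0..<19}. (d * 36) mod 19 \<in> {1, 18} \<longrightarrow> (\<forall>e\<in>{0..<19}.
     (\<exists>y\<in>{12..<18}. (d * 5 + e) mod 19 + (d * (y + 1) + e) mod 19 = (d * 6 + e) mod 19 + (d * y + e) mod (19::nat)))"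
  unfolding atLeastLessThan_upt by code_simp

lemma steps_13_3_3:
  "\<forall>d\<in>{0..<13}. (d * 9) mod 13 \<in> {1, 12} \<longrightarrow> (\<forall>e\<in>{0..<13}.
     (\<exists>y\<in>{7..<11}. (d * 2 + e) mod 13 + (d * (y + 1) + e) mod 13 = (d * 3 + e) mod 13 + (d * y + e) mod (13::nat))
     \<or> (\<forall>y\<in>{6, 11}. (d * 2 + e) mod 13 + (d * (y + 1) + e) mod 13 = (d * 3 + e) mod 13 + (d * y + e) mod (13::nat)))"
  unfolding atLeastLessThan_upt by code_simp

lemma steps_19_4_5:
  "\<forall>d\<in>{0..<19}. (d * 20) mod 19 \<in> {1, 18} \<longrightarrow> (\<forall>e\<in>{0..<19}.
     (\<exists>y\<in>{10..<16}. (d * 3 + e) mod 19 + (d * (y + 2) + e) mod 19 = (d * 5 + e) mod 19 + (d * y + e) mod (19::nat))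
     \<or> d = 1 \<and> e \<in> {14, 15} \<or> d = 18 \<and> e \<in> {3, 4})"
  unfolding atLeastLessThan_upt by code_simp

lemma steps_19_5_5:
  "\<forall>d\<in>{0..<19}. (d * 25) mod 19 \<in> {1, 18} \<longrightarrow> (\<forall>e\<in>{0..<19}.
     (\<exists>y\<in>{10..<18}. (d * 4 + e) mod 19 + (d * (y + 1) + e) mod 19 = (d * 5 + e) mod 19 + (d * y + e) mod (19::nat)
       \<and> (\<exists>z\<in>{10..<16}. (d * 3 + e) mod 19 + (d * (z + 3) + e) mod 19 = (d * 6 + e) mod 19 + (d * z + e) mod (19::nat)
         \<and> z \<noteq> y \<and> z \<noteq> y + 1 \<and> z + 3 \<noteq> y \<and> z + 3 \<noteq> y + 1)))"
  unfolding atLeastLessThan_upt by code_simp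

context residue_model_le
begin

text \<open>Ten triples \<open>(p, Q, R)\<close> have both linear bounds above
  \<open>2 p / 3\<close>. A sum above \<open>2 p / 3\<close> must reach \<open>p - R\<close> in
  seven of them, and at least \<open>p - R - 1\<close> in \<open>(13, 3, 3)\<close>,
  \<open>(19, 4, 5)\<close> and \<open>(19, 5, 5)\<close>.\<close>

lemma sum_D_exceptional:
  assumes p: "p \<in> {7, 11, 13, 19}"
    and d: "d < p" "(d * (Q * R)) mod p \<in> {1, p - 1}" and e: "e < p"
    and big: "2 * p < 3 * (p - R)" "2 * p < 3 * (2 * Q + R)"
  shows "3 * (\<Sum>a<p. D a) \<le> 2 * int p"
proof (rule ccontr)
  assume neg: "\<not> 3 * (\<Sum>a<p. D a) \<le> 2 * int p"
  have small: "3 * R < p" "2 * p < 6 * Q + 3 * R" "Q \<le> R"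
    using big R_less Q_le_R by auto
  have c7: "Q = 2 \<and> R = 2" if "p = 7" using small unfolding that by linarith
  have c11: "Q = 3 \<and> R = 3" if "p = 11" using small unfolding that by linarith
  have c13: "Q = 3 \<and> R = 3 \<or> Q = 3 \<and> R = 4 \<or> Q = 4 \<and> R = 4" if "p = 13"
    using small unfolding that by linarith
  have c19: "Q = 4 \<and> R = 5 \<or> Q = 4 \<and> R = 6 \<or> Q = 5 \<and> R = 5 \<or> Q = 5 \<and> R = 6 \<or> Q = 6 \<and> R = 6" if "p = 19"
    using small unfolding that by linarith
  have "p = 7 \<or> p = 11 \<or> p = 13 \<or> p = 19" using p by simp
  then have "p = 7 \<and> Q = 2 \<and> R = 2 \<or>
    p = 11 \<and> Q = 3 \<and> R = 3 \<or>
    p = 13 \<and> Q = 3 \<and> R = 3 \<or>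
    p = 13 \<and> Q = 3 \<and> R = 4 \<or>
    p = 13 \<and> Q = 4 \<and> R = 4 \<or>
    p = 19 \<and> Q = 4 \<and> R = 5 \<or>
    p = 19 \<and> Q = 4 \<and> R = 6 \<or>
    p = 19 \<and> Q = 5 \<and> R = 5 \<or>
    p = 19 \<and> Q = 5 \<and> R = 6 \<or>
    p = 19 \<and> Q = 6 \<and> R = 6"
    by (elim disjE) (use c7 c11 c13 c19 in simp_all)
  then show False
  proof (elim disjE conjE)
    assume 1: "p = 7" "Q = 2" "R = 2"
    have "\<exists>y\<in>{4..<6}. K 1 + K (y + 1) = K 2 + K y"
      using steps_7_2_2[rule_format, of d e] d e 1 unfolding K_def by simp
    then obtain y where "4 \<le> y" "y < 6" "K 1 + K (y + 1) = K 2 + K y" by auto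
    then show False using tight_contradiction[of y] neg 1 by simp
  next
    assume 2: "p = 11" "Q = 3" "R = 3"
    have "\<exists>y\<in>{6..<10}. K 2 + K (y + 1) = K 3 + K y"
      using steps_11_3_3[rule_format, of d e] d e 2 unfolding K_def by simp
    then obtain y where "6 \<le> y" "y < 10" "K 2 + K (y + 1) = K 3 + K y" by auto
    then show False using tight_contradiction[of y] neg 2 by simp
  next
    assume 3: "p = 13" "Q = 3" "R = 3"
    have *: "(\<exists>y\<in>{7..<11}. K 2 + K (y + 1) = K 3 + K y) \<or> (\<forall>y\<in>{6, 11}. K 2 + K (y + 1) = K 3 + K y)"
      using steps_13_3_3[rule_format, of d e] d e 3 unfolding K_def by simp
    show False
      by (rule near_tight_contradiction) (use neg 3 * in auto)
  next
    assume 4: "p = 13" "Q = 3" "R = 4"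
    have *: "(\<exists>y\<in>{7..<11}. K 2 + K (y + 2) = K 4 + K y) \<or> d = 12 \<and> e \<in> {2, 3} \<or> d = 1 \<and> e \<in> {9, 10}"
      using steps_13_3_4[rule_format, of d e] d e 4 unfolding K_def by simp
    have S: "int p - int R \<le> (\<Sum>a<p. D a)" using neg 4 by simp
    show False
    proof (cases "\<exists>y\<in>{7..<11}. K 2 + K (y + 2) = K 4 + K y")
      case True
      then obtain y where "7 \<le> y" "y < 11" "K 2 + K (y + 2) = K 4 + K y" by auto
      then show False using tight_contradiction[OF S, of y] 4 by simp
    next
      case False
      then have de: "d = 12 \<and> e = 2 \<or> d = 12 \<and> e = 3 \<or> d = 1 \<and> e = 9 \<or> d = 1 \<and> e = 10" using * by auto
      have zero: "defect a = 0" if "a < p" for a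
        using sum_defect_subset[of "{a}"] defect_nonneg[OF that] S that by simp
      have pos: "0 < D a" if "a < 13" "a < 3 \<or> 7 \<le> a" for a
        using zero[of a, unfolded defect_def] that 4 by auto
      have N: "N < 7" using N_less[of 7] zero[of 7] 4 by simp
      show False
      \<comment> \<open>The run consists of all high residues \<open>7\<close> to \<open>12\<close>;
        as \<open>d\<close> is \<open>\<plusminus> 1\<close> modulo \<open>13\<close>, the residue
        \<open>1\<close> continues it two steps beyond \<open>12\<close>.\<close>
      proof (rule run_contradiction[of 5 7 2 1])
        fix j :: nat assume j: "j + 2 \<le> 5"
        then have "j \<in> {0, 1, 2, 3}" by auto
        then show "K (7 + j) + K (7 + j + 2) = 2 * K (7 + j + 1)"
          using de 4 unfolding K_def by auto
      qed (use de 4 pos N in \<open>unfold K_def, auto\<close>)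
    qed
  next
    assume 5: "p = 13" "Q = 4" "R = 4"
    have "\<exists>y\<in>{8..<12}. K 3 + K (y + 1) = K 4 + K y"
      using steps_13_4_4[rule_format, of d e] d e 5 unfolding K_def by simp
    then obtain y where "8 \<le> y" "y < 12" "K 3 + K (y + 1) = K 4 + K y" by auto
    then show False using tight_contradiction[of y] neg 5 by simp
  next
    assume 6: "p = 19" "Q = 4" "R = 5"
    have *: "(\<exists>y\<in>{10..<16}. K 3 + K (y + 2) = K 5 + K y) \<or> d = 1 \<and> e \<in> {14, 15} \<or> d = 18 \<and> e \<in> {3, 4}"
      using steps_19_4_5[rule_format, of d e] d e 6 unfolding K_def by simp
    have S: "int p - int R - 1 \<le> (\<Sum>a<p. D a)" and p: "p = 2 * (Q + R) + 1" using neg 6 by simp_all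
    show False
    proof (cases "\<exists>y\<in>{10..<16}. K 3 + K (y + 2) = K 5 + K y")
      case True
      then obtain y where "10 \<le> y" "y < 16" "K 3 + K (y + 2) = K 5 + K y" by auto
      then have "Q + R < y \<and> y + (R + 1 - Q) < p - 1 \<and> K (Q - 1) + K (y + (R + 1 - Q)) = K R + K y"
        using 6 by simp
      then show False using near_tight_contradiction[OF S p] 6 by auto
    next
      case False
      then have de: "d = 1 \<and> e = 14 \<or> d = 1 \<and> e = 15 \<or> d = 18 \<and> e = 3 \<or> d = 18 \<and> e = 4" using * by auto
      have zero: "defect a = 0" if "a < 18" "a \<noteq> 9" for a
        using near_tight(1)[OF S p, of a] that 6 by simp
      have pos: "0 < D a" if "a < 18" "a < 4 \<or> 10 \<le> a" for a
        using zero[of a, unfolded defect_def] that 6 by auto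
      have N: "N < 10" using N_less[of 10] zero[of 10] 6 by simp
      show False
      \<comment> \<open>The run \<open>10\<close> to \<open>17\<close> avoids the possible defects
        at \<open>9\<close> and \<open>18\<close>; the residue \<open>0\<close> lies two steps
        beyond \<open>17\<close>.\<close>
      proof (rule run_contradiction[of 7 10 2 0])
        fix j :: nat assume j: "j + 2 \<le> 7"
        then have "j \<in> {0, 1, 2, 3, 4, 5}" by auto
        then show "K (10 + j) + K (10 + j + 2) = 2 * K (10 + j + 1)"
          using de 6 unfolding K_def by auto
      qed (use de 6 pos N in \<open>unfold K_def, auto\<close>)
    qed
  next
    assume 7: "p = 19" "Q = 4" "R = 6"
    have "\<exists>y\<in>{10..<16}. K 3 + K (y + 3) = K 6 + K y"
      using steps_19_4_6[rule_format, of d e] d e 7 unfolding K_def by simp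
    then obtain y where "10 \<le> y" "y < 16" "K 3 + K (y + 3) = K 6 + K y" by auto
    then show False using tight_contradiction[of y] neg 7 by simp
  next
    assume 8: "p = 19" "Q = 5" "R = 5"
    \<comment> \<open>One defect is allowed at an unknown place, so two disjoint parallelograms are
      needed for a contradiction.\<close>
    have "\<exists>y\<in>{10..<18}. K 4 + K (y + 1) = K 5 + K y \<and> (\<exists>z\<in>{10..<16}. K 3 + K (z + 3) = K 6 + K z
        \<and> z \<noteq> y \<and> z \<noteq> y + 1 \<and> z + 3 \<noteq> y \<and> z + 3 \<noteq> y + 1)"
      using steps_19_5_5[rule_format, of d e] d e 8 unfolding K_def by simp
    then obtain y z where "y \<in> {10..<18}" "z \<in> {10..<16}"
      and K: "K 4 + K (y + 1) = K 5 + K y" "K 3 + K (z + 3) = K 6 + K z"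
      and ne: "z \<noteq> y" "z \<noteq> y + 1" "z + 3 \<noteq> y" "z + 3 \<noteq> y + 1"
      by (elim bexE conjE) (rule that)
    then have "10 \<le> y" "y < 18" "10 \<le> z" "z < 16" by simp_all
    note yz = this K ne
    have one: "(\<Sum>a\<in>T. defect a) \<le> 1" if "T \<subseteq> {..<19}" for T
      using sum_defect_subset[of T] that neg 8 by simp
    \<comment> \<open>One of \<open>10, 11\<close> and one of \<open>17, 18\<close> is free of
      defect, which locates \<open>N\<close>.\<close>
    have "defect 10 + defect 11 \<le> 1" "defect 17 + defect 18 \<le> 1"
      using one[of "{10, 11}"] one[of "{17, 18}"] by simp_all
    then have "defect 10 = 0 \<or> defect 11 = 0" "defect 17 = 0 \<or> defect 18 = 0"
      using defect_nonneg[of 10] defect_nonneg[of 11] defect_nonneg[of 17] defect_nonneg[of 18] 8(1) by linarith+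
    then have N: "N < 11" "7 \<le> N"
      using N_less[of 10] N_less[of 11] N_ge[of 17] N_ge[of 18] 8 by auto
    have "1 \<le> defect 4 + defect y + defect (y + 1) + defect 5"
      using yz 8 N by (intro parallelogram_defect) auto
    moreover have "1 \<le> defect 3 + defect z + defect (z + 3) + defect 6"
      using yz 8 N by (intro parallelogram_defect) auto
    moreover have "(\<Sum>a\<in>{4, y, y + 1, 5, 3, z, z + 3, 6}. defect a) =
      defect 4 + defect y + defect (y + 1) + defect 5 + (defect 3 + defect z + defect (z + 3) + defect 6)"
      using yz by simp
    moreover have "(\<Sum>a\<in>{4, y, y + 1, 5, 3, z, z + 3, 6}. defect a) \<le> 1"
      using yz by (intro one) auto
    ultimately show False by linarith
  next
    assume 9: "p = 19" "Q = 5" "R = 6"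
    have "\<exists>y\<in>{11..<17}. K 4 + K (y + 2) = K 6 + K y"
      using steps_19_5_6[rule_format, of d e] d e 9 unfolding K_def by simp
    then obtain y where "11 \<le> y" "y < 17" "K 4 + K (y + 2) = K 6 + K y" by auto
    then show False using tight_contradiction[of y] neg 9 by simp
  next
    assume 10: "p = 19" "Q = 6" "R = 6"
    have "\<exists>y\<in>{12..<18}. K 5 + K (y + 1) = K 6 + K y"
      using steps_19_6_6[rule_format, of d e] d e 10 unfolding K_def by simp
    then obtain y where "12 \<le> y" "y < 18" "K 5 + K (y + 1) = K 6 + K y" by auto
    then show False using tight_contradiction[of y] neg 10 by simp
  qed
qed

lemma sum_D_two_thirds:
  assumes p: "p \<in> {3, 5, 7, 11, 13, 19}"
    and d: "d < p" "(d * (Q * R)) mod p \<in> {1, p - 1}" and e: "e < p"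
  shows "3 * (\<Sum>a<p. D a) \<le> 2 * int p"
proof (cases "2 * p < 3 * (p - R) \<and> 2 * p < 3 * (2 * Q + R)")
  case True
  then have "p \<in> {7, 11, 13, 19}"
    using p Q_le_R by (auto; presburger)
  then show ?thesis using sum_D_exceptional assms True by blast
next
  case False
  then show ?thesis using sum_D_le_diff sum_D_le_lin R_less by auto
qed

end

context residue_model
begin

text \<open>The second bound comes from the mean of \<open>p - max Q R\<close> and
  \<open>2 * min Q R + max Q R\<close>, which is at most \<open>p / 2 + Q\<close>. The bounds
  mention \<open>Q\<close> but not \<open>R\<close>, so they will be uniform in \<open>r\<close> for
  fixed \<open>q\<close>.\<close>

lemma sum_D_bounds:
  shows "\<bar>\<Sum>a<p. D a\<bar> \<le> int p - int Q" "2 * \<bar>\<Sum>a<p. D a\<bar> \<le> int p + 2 * int Q"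
    and "\<lbrakk>p \<in> {3, 5, 7, 11, 13, 19}; d < p; (d * (Q * R)) mod p \<in> {1, p - 1}; e < p\<rbrakk>
       \<Longrightarrow> 3 * \<bar>\<Sum>a<p. D a\<bar> \<le> 2 * int p"
proof -
  have "\<bar>\<Sum>a<p. D a\<bar> \<le> int p - int Q \<and> 2 * \<bar>\<Sum>a<p. D a\<bar> \<le> int p + 2 * int Q \<and>
    (p \<in> {3, 5, 7, 11, 13, 19} \<and> d < p \<and> (d * (Q * R)) mod p \<in> {1, p - 1} \<and> e < p \<longrightarrow>
       3 * \<bar>\<Sum>a<p. D a\<bar> \<le> 2 * int p)"
  proof (cases "Q \<le> R")
    case True
    interpret le: residue_model_le p Q R d e N \<beta> \<gamma> F
      by unfold_locales (rule True)
    show ?thesis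
      using le.sum_D_ge le.sum_D_le_diff le.sum_D_le_lin le.sum_D_two_thirds True Q_less R_less
      by (auto simp: abs_le_iff)
  next
    case False
    interpret s: residue_model p R Q d e N \<gamma> \<beta> F by (rule swap)
    interpret le: residue_model_le p R Q d e N \<gamma> \<beta> F
      by unfold_locales (use False in simp)
    have sum: "(\<Sum>a<p. s.D a) = (\<Sum>a<p. D a)" by (simp add: D_swap)
    show ?thesis
      using le.sum_D_ge le.sum_D_le_diff le.sum_D_le_lin le.sum_D_two_thirds False Q_less R_less
      unfolding sum by (auto simp: abs_le_iff mult.commute[of Q R])
  qed
  then show "\<bar>\<Sum>a<p. D a\<bar> \<le> int p - int Q" "2 * \<bar>\<Sum>a<p. D a\<bar> \<le> int p + 2 * int Q"
    and "\<lbrakk>p \<in> {3, 5, 7, 11, 13, 19}; d < p; (d * (Q * R)) mod p \<in> {1, p - 1}; e < p\<rbrakk>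
       \<Longrightarrow> 3 * \<bar>\<Sum>a<p. D a\<bar> \<le> 2 * int p" by blast+
qed

end

section \<open>Digits of the integers in a window\<close>

locale ternary_residues =
  fixes p q r :: nat and x y z :: int
  assumes primes: "prime p" "prime q" "prime r" and ne: "p \<noteq> q" "p \<noteq> r" "q \<noteq> r"
    and bezout: "x * (int q * int r) + y * (int r * int p) + z * (int p * int q) = 1"
begin

definition ra :: "int \<Rightarrow> int" where "ra k = (k * x) mod int p"
definition rb :: "int \<Rightarrow> int" where "rb k = (k * y) mod int q"
definition rc :: "int \<Rightarrow> int" where "rc k = (k * z) mod int r"
text \<open>The multiple of \<open>p * q * r\<close> by which the number with the reduced digits
  exceeds \<open>k\<close>; it becomes \<open>F\<close> in the residue model.\<close>

definition carry :: "int \<Rightarrow> int" where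
  "carry k = - (k * x div int p + k * y div int q + k * z div int r)"

lemma pos: "0 < int p" "0 < int q" "0 < int r"
  using primes by (simp_all add: prime_gt_0_nat)

lemma ranges: "0 \<le> ra k" "ra k < int p" "0 \<le> rb k" "rb k < int q" "0 \<le> rc k" "rc k < int r"
  using pos by (simp_all add: ra_def rb_def rc_def)

lemma carry_eq:
  "ra k * (int q * int r) + rb k * (int r * int p) + rc k * (int p * int q) = k + carry k * (int p * int q * int r)"
proof -
  have red: "ra k = k * x - (k * x div int p) * int p" "rb k = k * y - (k * y div int q) * int q"
    "rc k = k * z - (k * z div int r) * int r"
    by (simp_all add: ra_def rb_def rc_def minus_div_mult_eq_mod)
  have "ra k * (int q * int r) + rb k * (int r * int p) + rc k * (int p * int q) =
    k * (x * (int q * int r) + y * (int r * int p) + z * (int p * int q)) + carry k * (int p * int q * int r)"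
    unfolding carry_def red by (simp add: algebra_simps)
  then show ?thesis unfolding bezout by simp
qed

text \<open>Modulo each prime only one digit survives. Thus any reduced expansion of a shifted
  integer reveals its digits and carry.\<close>

lemma residues_unique:
  assumes "0 \<le> a" "a < int p" "0 \<le> b" "b < int q" "0 \<le> c" "c < int r"
    and eq: "a * (int q * int r) + b * (int r * int p) + c * (int p * int q) = k + f * (int p * int q * int r)"
  shows "a = ra k \<and> b = rb k \<and> c = rc k \<and> f = carry k"
proof -
  have eq0: "(a - ra k) * (int q * int r) + (b - rb k) * (int r * int p) + (c - rc k) * (int p * int q)
      = (f - carry k) * (int p * int q * int r)"
    using eq carry_eq[of k] by (simp add: algebra_simps)
  have cop: "coprime (int p) (int q * int r)" "coprime (int q) (int r * int p)" "coprime (int r) (int p * int q)"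
    using primes ne primes_coprime[of p q] primes_coprime[of p r] primes_coprime[of q r]
    by (auto simp: coprime_commute)
  have zero: "u = u'" if "0 \<le> u" "u < m" "0 \<le> u'" "u' < m" "m dvd (u - u')" for u u' m :: int
    using that by (metis mod_eq_dvd_iff mod_pos_pos_trivial)
  have "(a - ra k) * (int q * int r) = int p * ((f - carry k) * (int q * int r) - (b - rb k) * int r - (c - rc k) * int q)"
    using eq0 by (simp add: algebra_simps)
  then have "int p dvd (a - ra k) * (int q * int r)" by (metis dvd_triv_left)
  then have a: "a = ra k"
    using cop ranges assms by (intro zero) (auto simp: coprime_dvd_mult_left_iff)
  have "(b - rb k) * (int r * int p) = int q * ((f - carry k) * (int p * int r) - (a - ra k) * int r - (c - rc k) * int p)"
    using eq0 by (simp add: algebra_simps)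
  then have "int q dvd (b - rb k) * (int r * int p)" by (metis dvd_triv_left)
  then have b: "b = rb k"
    using cop ranges assms by (intro zero) (auto simp: coprime_dvd_mult_left_iff)
  have "(c - rc k) * (int p * int q) = int r * ((f - carry k) * (int p * int q) - (a - ra k) * int q - (b - rb k) * int p)"
    using eq0 by (simp add: algebra_simps)
  then have "int r dvd (c - rc k) * (int p * int q)" by (metis dvd_triv_left)
  then have c: "c = rc k"
    using cop ranges assms by (intro zero) (auto simp: coprime_dvd_mult_left_iff)
  show ?thesis using a b c eq0 pos by simp
qed

lemma carry_nonneg:
  assumes "k < int p * int q * int r"
  shows "0 \<le> carry k"
proof -
  let ?M = "int p * int q * int r"
  have "0 \<le> k + carry k * ?M"
    using carry_eq[of k] ranges[of k] by (metis add_nonneg_nonneg mult_nonneg_nonneg of_nat_0_le_iff)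
  then have "- 1 * ?M < carry k * ?M" using assms by simp
  then have "-1 < carry k" using pos by (metis mult_less_cancel_right_pos mult_pos_pos)
  then show ?thesis by simp
qed

lemma represented_iff: "represented p q r k \<longleftrightarrow> carry k = 0"
proof
  assume "represented p q r k"
  then show "carry k = 0"
    unfolding represented_def using residues_unique[of _ _ _ k 0] by fastforce
next
  assume "carry k = 0"
  then show "represented p q r k"
    unfolding represented_def using carry_eq[of k] ranges[of k]
    by (intro exI[of _ "ra k"] exI[of _ "rb k"] exI[of _ "rc k"]) simp
qed

section \<open>Carries of shifted integers\<close>

context
  fixes A1 P A2 Q e1 e2 :: int
  assumes A1: "A1 * int r + P * int p = e1 + int p * int r" "0 < A1" "A1 < int p" "0 < P" "P < int r"
    and A2: "A2 * int q + Q * int p = e2 + int p * int q" "0 < A2" "A2 < int p" "0 < Q" "Q < int q"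
    and A12: "A1 + A2 < int p"
begin

text \<open>Multiplied by \<open>q\<close>, the equation for \<open>A1\<close> shows that
  \<open>e1 * q\<close> has digits \<open>A1, 0, P\<close> and carry \<open>1\<close>. Subtraction
  digit by digit borrows exactly where the digit of \<open>k\<close> is smaller.\<close>

lemma carry_shift_q: "carry (k - e1 * int q) = carry k + of_bool (ra k < A1) - of_bool (P \<le> rc k)"
proof -
  let ?a = "ra k - A1 + int p * of_bool (ra k < A1)"
  let ?c = "rc k - P + int r * of_bool (rc k < P)"
  have "?a * (int q * int r) + rb k * (int r * int p) + ?c * (int p * int q) =
     (ra k * (int q * int r) + rb k * (int r * int p) + rc k * (int p * int q)) - (A1 * int r + P * int p) * int q
     + (of_bool (ra k < A1) + of_bool (rc k < P)) * (int p * int q * int r)"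
    by (simp add: algebra_simps)
  also have "\<dots> = (k - e1 * int q) + (carry k - 1 + of_bool (ra k < A1) + of_bool (rc k < P)) * (int p * int q * int r)"
    unfolding carry_eq A1(1) by (simp add: algebra_simps)
  finally have "carry k - 1 + of_bool (ra k < A1) + of_bool (rc k < P) = carry (k - e1 * int q)"
    using ranges[of k] A1 by (intro residues_unique[THEN conjunct2, THEN conjunct2, THEN conjunct2]) auto
  then show ?thesis by (cases "rc k < P") auto
qed

lemma carry_shift_r: "carry (k - e2 * int r) = carry k + of_bool (ra k < A2) - of_bool (Q \<le> rb k)"
proof -
  let ?a = "ra k - A2 + int p * of_bool (ra k < A2)"
  let ?b = "rb k - Q + int q * of_bool (rb k < Q)"
  have "?a * (int q * int r) + ?b * (int r * int p) + rc k * (int p * int q) =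
     (ra k * (int q * int r) + rb k * (int r * int p) + rc k * (int p * int q)) - (A2 * int q + Q * int p) * int r
     + (of_bool (ra k < A2) + of_bool (rb k < Q)) * (int p * int q * int r)"
    by (simp add: algebra_simps)
  also have "\<dots> = (k - e2 * int r) + (carry k - 1 + of_bool (ra k < A2) + of_bool (rb k < Q)) * (int p * int q * int r)"
    unfolding carry_eq A2(1) by (simp add: algebra_simps)
  finally have "carry k - 1 + of_bool (ra k < A2) + of_bool (rb k < Q) = carry (k - e2 * int r)"
    using ranges[of k] A2 by (intro residues_unique[THEN conjunct2, THEN conjunct2, THEN conjunct2]) auto
  then show ?thesis by (cases "rb k < Q") auto
qed

text \<open>Since \<open>A1 + A2 < p\<close>, both shifts together need at most one borrow in the
  first digit.\<close>

lemma carry_shift_qr: "carry (k - e1 * int q - e2 * int r) =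
  carry k + of_bool (ra k < A1 + A2) - of_bool (Q \<le> rb k) - of_bool (P \<le> rc k)"
proof -
  let ?a = "ra k - (A1 + A2) + int p * of_bool (ra k < A1 + A2)"
  let ?b = "rb k - Q + int q * of_bool (rb k < Q)"
  let ?c = "rc k - P + int r * of_bool (rc k < P)"
  have "?a * (int q * int r) + ?b * (int r * int p) + ?c * (int p * int q) =
     (ra k * (int q * int r) + rb k * (int r * int p) + rc k * (int p * int q)) - (A2 * int q + Q * int p) * int r
     - (A1 * int r + P * int p) * int q
     + (of_bool (ra k < A1 + A2) + of_bool (rb k < Q) + of_bool (rc k < P)) * (int p * int q * int r)"
    by (simp add: algebra_simps)
  also have "\<dots> = (k - e1 * int q - e2 * int r) +
    (carry k - 2 + of_bool (ra k < A1 + A2) + of_bool (rb k < Q) + of_bool (rc k < P)) * (int p * int q * int r)"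
    unfolding carry_eq A1(1) A2(1) by (simp add: algebra_simps)
  finally have "carry k - 2 + of_bool (ra k < A1 + A2) + of_bool (rb k < Q) + of_bool (rc k < P) =
      carry (k - e1 * int q - e2 * int r)"
    using ranges[of k] A1 A2 A12 by (intro residues_unique[THEN conjunct2, THEN conjunct2, THEN conjunct2]) auto
  then show ?thesis by (cases "rb k < Q"; cases "rc k < P") auto
qed

end

end

section \<open>Windows as instances of the residue model\<close>

context ternary_residues
begin

definition signed_diff :: "int \<Rightarrow> int \<Rightarrow> int \<Rightarrow> int" where
  "signed_diff e1 e2 k = chi p q r k - chi p q r (k - e1 * int q) - chi p q r (k - e2 * int r)
     + chi p q r (k - e1 * int q - e2 * int r)"

context
  fixes A1 A2 :: nat and P Q e1 e2 k1 :: int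
  assumes A1: "int A1 * int r + P * int p = e1 + int p * int r" "0 < A1" "2 * A1 < p" "0 < P" "P < int r"
    and A2: "int A2 * int q + Q * int p = e2 + int p * int q" "0 < A2" "2 * A2 < p" "0 < Q" "Q < int q"
    and e12: "e1 \<in> {1, -1}" "e2 \<in> {1, -1}"
    and p: "3 \<le> p" "p < q"
    and k1: "k1 < int p * int q * int r" "k1 - e1 * int q < int p * int q * int r"
      "k1 - e2 * int r < int p * int q * int r" "k1 - e1 * int q - e2 * int r < int p * int q * int r"
begin

text \<open>An integer \<open>k\<close> with \<open>ra k = a\<close> is \<open>a * q * r\<close>
  modulo \<open>p\<close>, so its distance from the top \<open>k1\<close> of the window is
  \<open>k1 - a * q * r\<close> modulo \<open>p\<close>, which is affine in
  \<open>a\<close>.\<close>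

definition step :: nat where "step = nat ((- (int q * int r)) mod int p)"
definition offset :: nat where "offset = nat (k1 mod int p)"
definition index :: "nat \<Rightarrow> nat" where "index a = (step * a + offset) mod p"
definition pos_of :: "nat \<Rightarrow> int" where "pos_of a = k1 - int (index a)"
lemma step_cong: "[int step = - (int q * int r)] (mod int p)"
  unfolding step_def cong_def using pos by simp

lemma index_less: "index a < p"
  unfolding index_def using pos by simp

lemma ra_pos_of:
  assumes "a < p"
  shows "ra (pos_of a) = int a"
proof -
  have off: "[int offset = k1] (mod int p)"
    unfolding offset_def cong_def using pos by simp
  have "[int (index a) = int step * int a + int offset] (mod int p)"
    unfolding index_def cong_def by (simp add: zmod_int)
  also have "[int step * int a + int offset = - (int q * int r) * int a + k1] (mod int p)"
    by (intro cong_add cong_mult step_cong off cong_refl)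
  finally have "[pos_of a = k1 - (- (int q * int r) * int a + k1)] (mod int p)"
    unfolding pos_of_def by (intro cong_diff cong_refl)
  then have "[pos_of a = int a * (int q * int r)] (mod int p)"
    by (simp add: algebra_simps)
  then have "[pos_of a * x = int a * (int q * int r) * x] (mod int p)"
    by (intro cong_mult cong_refl)
  also have "int a * (int q * int r) * x = int a * (x * (int q * int r))" by simp
  also have "[\<dots> = int a * 1] (mod int p)"
  proof (intro cong_mult cong_refl)
    have "x * (int q * int r) - 1 = int p * (- (y * int r) - z * int q)"
      using bezout by (simp add: algebra_simps)
    then show "[x * (int q * int r) = 1] (mod int p)"
      unfolding cong_iff_dvd_diff by (metis dvd_triv_left)
  qed
  finally show ?thesis
    using assms by (simp add: ra_def cong_def)
qed

lemma bij_index: "bij_betw index {..<p} {..<p}"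
proof -
  have "inj_on index {..<p}"
  proof (rule inj_onI)
    fix a a' assume a: "a \<in> {..<p}" "a' \<in> {..<p}" "index a = index a'"
    then have "ra (pos_of a) = ra (pos_of a')" by (simp add: pos_of_def)
    then show "a = a'" using a ra_pos_of by simp
  qed
  moreover have "index ` {..<p} \<subseteq> {..<p}" using index_less by auto
  ultimately show ?thesis
    using endo_inj_surj[of "{..<p}" index] by (simp add: bij_betw_def)
qed

text \<open>
  The terms \<open>1 / q\<close>, \<open>1 / r\<close> and \<open>index a / (q r)\<close> absorb the signs \<open>e1, e2\<close> and the variation of
  \<open>k\<close> inside the window.
\<close>
definition beta :: "nat \<Rightarrow> real" where
  "beta a = real p * rb (pos_of a) / q + 1 / q"
definition gamma :: "nat \<Rightarrow> real" where
  "gamma a = real p * rc (pos_of a) / r + 1 / r + index a / (real q * real r)"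
definition level :: real where
  "level = k1 / (real q * real r) + 1 / q + 1 / r"

lemma rpos: "0 < real p" "0 < real q" "0 < real r"
  using pos by simp_all

lemma index_ratio: "0 \<le> index a / real q" "index a / real q < 1"
  using index_less[of a] p by (simp_all add: divide_less_eq)

lemma beta_ge_iff: "beta a \<ge> p - A2 \<longleftrightarrow> Q \<le> rb (pos_of a)"
proof -
  let ?b = "rb (pos_of a)"
  have "beta a \<ge> p - A2 \<longleftrightarrow> real q * beta a \<ge> real q * (real p - real A2)"
    using rpos A2 by (simp add: of_nat_diff)
  also have "real q * beta a = real_of_int (int p * ?b + 1)"
    unfolding beta_def using rpos by (simp add: field_simps)
  also have "real q * (real p - real A2) = real_of_int (int q * (int p - int A2))" by simp
  also have "int q * (int p - int A2) = Q * int p - e2" using A2(1) by (simp add: algebra_simps)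
  also have "real_of_int (Q * int p - e2) \<le> real_of_int (int p * ?b + 1) \<longleftrightarrow> Q * int p - e2 \<le> int p * ?b + 1"
    by (simp only: of_int_le_iff)
  also have "\<dots> \<longleftrightarrow> Q \<le> ?b"
  proof
    assume "Q * int p - e2 \<le> int p * ?b + 1"
    \<comment> \<open>The shift by \<open>1\<close> and the sign \<open>e2\<close> together cost at
      most \<open>2\<close>, less than \<open>p\<close>.\<close>
    then have "int p * Q \<le> int p * ?b + 2" using e12 by (auto simp: mult.commute)
    then have "int p * Q < int p * (?b + 1)" using p by (simp add: algebra_simps)
    then show "Q \<le> ?b" using pos by (simp add: mult_less_cancel_left_pos)
  next
    assume "Q \<le> ?b"
    then have "int p * Q \<le> int p * ?b" using pos by (intro mult_left_mono) auto
    then show "Q * int p - e2 \<le> int p * ?b + 1" using e12 by (auto simp: mult.commute)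
  qed
  finally show ?thesis .
qed

lemma gamma_ge_iff: "gamma a \<ge> p - A1 \<longleftrightarrow> P \<le> rc (pos_of a)"
proof -
  let ?c = "rc (pos_of a)"
  have "gamma a \<ge> p - A1 \<longleftrightarrow> real r * gamma a \<ge> real r * (real p - real A1)"
    using rpos A1 by (simp add: of_nat_diff)
  also have "real r * gamma a = real_of_int (int p * ?c + 1) + index a / real q"
    unfolding gamma_def using rpos by (simp add: field_simps)
  also have "real r * (real p - real A1) = real_of_int (int r * (int p - int A1))" by simp
  also have "int r * (int p - int A1) = P * int p - e1" using A1(1) by (simp add: algebra_simps)
  also have "real_of_int (P * int p - e1) \<le> real_of_int (int p * ?c + 1) + index a / real q \<longleftrightarrow> P \<le> ?c"
  proof
    assume "real_of_int (P * int p - e1) \<le> real_of_int (int p * ?c + 1) + index a / real q"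
    then have "real_of_int (P * int p - e1) < real_of_int (int p * ?c + 2)"
      using index_ratio[of a] by simp
    then have "P * int p - e1 < int p * ?c + 2" by (simp only: of_int_less_iff)
    then have "int p * P < int p * ?c + 3" using e12 by (auto simp: mult.commute)
    then have "int p * P < int p * (?c + 1)" using p by (simp add: algebra_simps)
    then show "P \<le> ?c" using pos by (simp add: mult_less_cancel_left_pos)
  next
    assume "P \<le> ?c"
    then have "int p * P \<le> int p * ?c" using pos by (intro mult_left_mono) auto
    then have "P * int p - e1 \<le> int p * ?c + 1" using e12 by (auto simp: mult.commute)
    then have "real_of_int (P * int p - e1) \<le> real_of_int (int p * ?c + 1)" by (simp only: of_int_le_iff)
    then show "real_of_int (P * int p - e1) \<le> real_of_int (int p * ?c + 1) + index a / real q"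
      using index_ratio[of a] by linarith
  qed
  finally show ?thesis .
qed

lemma carry_pos_of_shifts:
  assumes "a < p"
  shows "carry (pos_of a - e1 * int q) = carry (pos_of a) + of_bool (a < A1) - of_bool (gamma a \<ge> p - A1)"
    "carry (pos_of a - e2 * int r) = carry (pos_of a) + of_bool (a < A2) - of_bool (beta a \<ge> p - A2)"
    "carry (pos_of a - e1 * int q - e2 * int r) = carry (pos_of a) + of_bool (a < A2 + A1)
       - of_bool (beta a \<ge> p - A2) - of_bool (gamma a \<ge> p - A1)"
proof -
  have A: "0 < int A1" "int A1 < int p" "0 < int A2" "int A2 < int p" "int A1 + int A2 < int p"
    using A1 A2 by auto
  note s = carry_shift_q[OF A1(1) A(1,2) A1(4,5)  A2(1) A(3,4) A2(4,5) A(5)]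
     carry_shift_r[OF A1(1) A(1,2) A1(4,5)  A2(1) A(3,4) A2(4,5) A(5)]
     carry_shift_qr[OF A1(1) A(1,2) A1(4,5)  A2(1) A(3,4) A2(4,5) A(5)]
  show "carry (pos_of a - e1 * int q) = carry (pos_of a) + of_bool (a < A1) - of_bool (gamma a \<ge> p - A1)"
    "carry (pos_of a - e2 * int r) = carry (pos_of a) + of_bool (a < A2) - of_bool (beta a \<ge> p - A2)"
    "carry (pos_of a - e1 * int q - e2 * int r) = carry (pos_of a) + of_bool (a < A2 + A1)
       - of_bool (beta a \<ge> p - A2) - of_bool (gamma a \<ge> p - A1)"
    using s[of "pos_of a"] unfolding ra_pos_of[OF assms] beta_ge_iff gamma_ge_iff by (simp_all add: add.commute)
qed

lemma carry_pos_of_nonneg: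
  "0 \<le> carry (pos_of a)" "0 \<le> carry (pos_of a - e1 * int q)" "0 \<le> carry (pos_of a - e2 * int r)"
  "0 \<le> carry (pos_of a - e1 * int q - e2 * int r)"
  using k1 by (auto intro!: carry_nonneg simp: pos_of_def)

lemma model: "residue_model p A2 A1 step offset level beta gamma (\<lambda>a. carry (pos_of a))"
proof
  show "2 * A2 < p" "2 * A1 < p" "0 < A2" "0 < A1" using A1 A2 by auto
next
  fix a assume a: "a < p"
  note [simp] = carry_pos_of_shifts[OF a]
  show "0 \<le> carry (pos_of a)" by (rule carry_pos_of_nonneg)
  show "0 \<le> carry (pos_of a) + of_bool (a < A1) - of_bool (gamma a \<ge> p - A1)"
    "0 \<le> carry (pos_of a) + of_bool (a < A2) - of_bool (beta a \<ge> p - A2)"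
    "0 \<le> carry (pos_of a) + of_bool (a < A2 + A1) - of_bool (beta a \<ge> p - A2) - of_bool (gamma a \<ge> p - A1)"
    using carry_pos_of_nonneg(2-4)[of a] by simp_all
  have b: "0 \<le> real_of_int (rb (pos_of a))" "real_of_int (rb (pos_of a)) \<le> real q - 1"
    and c: "0 \<le> real_of_int (rc (pos_of a))" "real_of_int (rc (pos_of a)) \<le> real r - 1"
    using ranges[of "pos_of a"] by linarith+
  have "real p * rb (pos_of a) \<le> real p * (real q - 1)"
    using b by (intro mult_left_mono) auto
  then have "real p * rb (pos_of a) + 1 < real p * real q"
    using p by (simp add: algebra_simps)
  then show "0 < beta a \<and> beta a < p"
    unfolding beta_def using rpos b by (simp add: field_simps add_pos_nonneg)
  have "real p * rc (pos_of a) \<le> real p * (real r - 1)"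
    using c by (intro mult_left_mono) auto
  then have "real p * rc (pos_of a) \<le> real p * real r - real p"
    by (simp add: algebra_simps)
  moreover have "3 \<le> real p" using p by simp
  ultimately have "real p * rc (pos_of a) + 1 + index a / real q < real p * real r"
    using index_ratio(2)[of a] by linarith
  then have "(real p * rc (pos_of a) + 1 + index a / real q) / real r < real p"
    using rpos by (simp add: divide_less_eq)
  moreover have "gamma a = (real p * rc (pos_of a) + 1 + index a / real q) / real r"
    unfolding gamma_def by (simp add: add_divide_distrib)
  moreover have "0 < real p * rc (pos_of a) + 1 + index a / real q"
    using c rpos index_ratio[of a] by (intro add_nonneg_pos add_pos_nonneg) auto
  ultimately show "0 < gamma a \<and> gamma a < p"
    using rpos by simp
  have "int a * (int q * int r) + rb (pos_of a) * (int r * int p) + rc (pos_of a) * (int p * int q)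
      = k1 - int (index a) + carry (pos_of a) * (int p * int q * int r)"
    using carry_eq[of "pos_of a"] ra_pos_of[OF a] by (simp add: pos_of_def)
  then have "real_of_int (int a * (int q * int r) + rb (pos_of a) * (int r * int p) + rc (pos_of a) * (int p * int q))
      = real_of_int (k1 - int (index a) + carry (pos_of a) * (int p * int q * int r))"
    by (simp only: of_int_eq_iff)
  then have "a * (real q * real r) + rb (pos_of a) * (real r * real p) + rc (pos_of a) * (real p * real q)
      = k1 - index a + carry (pos_of a) * (real p * real q * real r)"
    by simp
  \<comment> \<open>Division of the digit equation by \<open>q * r\<close> gives the affine relation
    once the window position is moved into \<open>gamma\<close>.\<close>
  then have "(a * (real q * real r) + rb (pos_of a) * (real r * real p) + rc (pos_of a) * (real p * real q)) / (real q * real r)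
      = (k1 - index a + carry (pos_of a) * (real p * real q * real r)) / (real q * real r)"
    by (simp only:)
  then show "a + beta a + gamma a = level + real p * of_int (carry (pos_of a))"
    unfolding beta_def gamma_def level_def using rpos
    by (simp add: add_divide_distrib diff_divide_distrib mult.commute; linarith)
next
  fix a1 a2 a3 a4
  assume "(step * a1 + offset) mod p + (step * a4 + offset) mod p = (step * a2 + offset) mod p + (step * a3 + offset) mod p"
  then have i: "index a1 + index a4 = index a2 + index a3" by (simp add: index_def)
  then have k: "pos_of a1 + pos_of a4 = pos_of a2 + pos_of a3"
    unfolding pos_of_def by (simp add: algebra_simps)
  \<comment> \<open>Reduction modulo \<open>m\<close> is additive up to multiples of
    \<open>m\<close>, so equal sums of positions give congruent sums of digits.\<close>
  have lin: "\<exists>t. (pos_of a1 * u) mod m + (pos_of a4 * u) mod m = (pos_of a2 * u) mod m + (pos_of a3 * u) mod m + m * t"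
    for u m :: int
  proof -
    have "((pos_of a1 * u) mod m + (pos_of a4 * u) mod m) mod m = ((pos_of a1 + pos_of a4) * u) mod m"
      by (simp add: mod_add_eq distrib_right)
    moreover have "((pos_of a2 * u) mod m + (pos_of a3 * u) mod m) mod m = ((pos_of a2 + pos_of a3) * u) mod m"
      by (simp add: mod_add_eq distrib_right)
    ultimately have "m dvd ((pos_of a1 * u) mod m + (pos_of a4 * u) mod m) - ((pos_of a2 * u) mod m + (pos_of a3 * u) mod m)"
      unfolding k by (metis mod_eq_dvd_iff)
    then show ?thesis by (auto elim!: dvdE simp: algebra_simps)
  qed
  obtain t where "rb (pos_of a1) + rb (pos_of a4) = rb (pos_of a2) + rb (pos_of a3) + int q * t"
    using lin[of y "int q"] unfolding rb_def by blast
  then have "real_of_int (rb (pos_of a1) + rb (pos_of a4)) = real_of_int (rb (pos_of a2) + rb (pos_of a3) + int q * t)"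
    by (simp only: of_int_eq_iff)
  then have *: "real_of_int (rb (pos_of a1)) + real_of_int (rb (pos_of a4))
      = real_of_int (rb (pos_of a2)) + real_of_int (rb (pos_of a3)) + real q * t" by simp
  have "beta a1 + beta a4 = real p / q * (real_of_int (rb (pos_of a1)) + real_of_int (rb (pos_of a4))) + 2 / q"
    unfolding beta_def by (simp add: add_divide_distrib distrib_left)
  also have "\<dots> = beta a2 + beta a3 + real p * of_int t"
    unfolding * beta_def using rpos by (simp add: add_divide_distrib distrib_left)
  finally show "\<exists>t::int. beta a1 + beta a4 = beta a2 + beta a3 + real p * of_int t" by blast
  obtain t where "rc (pos_of a1) + rc (pos_of a4) = rc (pos_of a2) + rc (pos_of a3) + int r * t"
    using lin[of z "int r"] unfolding rc_def by blast
  then have "real_of_int (rc (pos_of a1) + rc (pos_of a4)) = real_of_int (rc (pos_of a2) + rc (pos_of a3) + int r * t)"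
    by (simp only: of_int_eq_iff)
  then have *: "real_of_int (rc (pos_of a1)) + real_of_int (rc (pos_of a4))
      = real_of_int (rc (pos_of a2)) + real_of_int (rc (pos_of a3)) + real r * t" by simp
  have i': "real (index a1) + real (index a4) = real (index a2) + real (index a3)"
    using i by (metis of_nat_add)
  have "gamma a1 + gamma a4 = real p / r * (real_of_int (rc (pos_of a1)) + real_of_int (rc (pos_of a4))) + 2 / r
      + (real (index a1) + real (index a4)) / (real q * real r)"
    unfolding gamma_def by (simp add: add_divide_distrib distrib_left)
  also have "\<dots> = gamma a2 + gamma a3 + real p * of_int t"
    unfolding * i' gamma_def using rpos by (simp add: add_divide_distrib distrib_left)
  finally show "\<exists>t::int. gamma a1 + gamma a4 = gamma a2 + gamma a3 + real p * of_int t" by blast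
qed

text \<open>Up to the signs, \<open>A1\<close> and \<open>A2\<close> invert \<open>r\<close> and
  \<open>q\<close>; since \<open>step\<close> is \<open>- q * r\<close>, its product with both is
  \<open>- e1 * e2\<close> modulo \<open>p\<close>.\<close>

lemma step_props: "step < p" "offset < p" "(step * (A2 * A1)) mod p \<in> {1, p - 1}"
proof -
  show "step < p" "offset < p"
    unfolding step_def offset_def using pos by (simp_all add: nat_less_iff)
  have "int A1 * int r - e1 = int p * (int r - P)" "int A2 * int q - e2 = int p * (int q - Q)"
    using A1(1) A2(1) by (simp_all add: algebra_simps)
  then have "[int A1 * int r = e1] (mod int p)" "[int A2 * int q = e2] (mod int p)"
    unfolding cong_iff_dvd_diff by (metis dvd_triv_left)+
  then have "[(int A1 * int r) * (int A2 * int q) = e1 * e2] (mod int p)"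
    by (rule cong_mult)
  moreover have "[int step * (int A2 * int A1) = - (int q * int r) * (int A2 * int A1)] (mod int p)"
    by (intro cong_mult step_cong cong_refl)
  moreover have "- (int q * int r) * (int A2 * int A1) = - ((int A1 * int r) * (int A2 * int q))"
    by simp
  ultimately have c: "[int (step * (A2 * A1)) = - (e1 * e2)] (mod int p)"
    by (metis cong_minus_minus_iff cong_trans of_nat_mult)
  have "- (e1 * e2) = 1 \<or> - (e1 * e2) = -1" using e12 by auto
  then have "int ((step * (A2 * A1)) mod p) = 1 \<or> int ((step * (A2 * A1)) mod p) = int p - 1"
    using c p by (auto simp: cong_def zmod_int zmod_minus1)
  then show "(step * (A2 * A1)) mod p \<in> {1, p - 1}"
    using p by auto
qed

lemma window_bounds:
  defines "S \<equiv> \<Sum>i<p. signed_diff e1 e2 (k1 - int i)"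
  shows "\<bar>S\<bar> \<le> int p - int A2" "2 * \<bar>S\<bar> \<le> int p + 2 * int A2"
    "p \<in> {3, 5, 7, 11, 13, 19} \<Longrightarrow> 3 * \<bar>S\<bar> \<le> 2 * int p"
proof -
  interpret residue_model p A2 A1 step offset level beta gamma "\<lambda>a. carry (pos_of a)"
    by (rule model)
  have "S = (\<Sum>a<p. signed_diff e1 e2 (k1 - int (index a)))"
    unfolding S_def using sum.reindex_bij_betw[OF bij_index, of "\<lambda>i. signed_diff e1 e2 (k1 - int i)"] by simp
  also have "\<dots> = (\<Sum>a<p. D a)"
  proof (rule sum.cong[OF refl])
    fix a assume "a \<in> {..<p}"
    then have "a < p" by simp
    then show "signed_diff e1 e2 (k1 - int (index a)) = D a"
      unfolding D_def signed_diff_def chi_def represented_iff B_def C_def pos_of_def[symmetric] carry_pos_of_shifts[OF \<open>a < p\<close>]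
      by simp
  qed
  finally have S: "S = (\<Sum>a<p. D a)" .
  show "\<bar>S\<bar> \<le> int p - int A2" "2 * \<bar>S\<bar> \<le> int p + 2 * int A2"
    "p \<in> {3, 5, 7, 11, 13, 19} \<Longrightarrow> 3 * \<bar>S\<bar> \<le> 2 * int p"
    unfolding S using sum_D_bounds step_props by blast+
qed

end

end

section \<open>Bounds for the heights\<close>

text \<open>Of an inverse and its negative modulo \<open>p\<close> one lies below
  \<open>p / 2\<close>; \<open>e\<close> records the choice.\<close>

lemma exists_signed_inverse:
  fixes p r :: nat
  assumes "prime p" "odd p" "\<not> p dvd r"
  shows "\<exists>A e. 0 < A \<and> 2 * A < p \<and> e \<in> {1, -1} \<and> [int A * int r = e] (mod int p)"
proof -
  have "coprime r p" using assms by (metis coprime_commute prime_imp_coprime)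
  then obtain s where s: "[r * s = 1] (mod p)" by (metis cong_solve_coprime_nat One_nat_def)
  define a where "a = s mod p"
  have p: "1 < p" using assms(1) by (rule prime_gt_1_nat)
  have "[r * a = 1] (mod p)" unfolding a_def using s by (simp add: cong_def mod_mult_right_eq)
  then have a: "[int a * int r = 1] (mod int p)"
    by (metis cong_int_iff mult.commute of_nat_1 of_nat_mult)
  have "a < p" using p by (simp add: a_def)
  have "a \<noteq> 0"
  proof
    assume "a = 0"
    then show False using a p by (simp add: cong_def)
  qed
  show ?thesis
  proof (cases "2 * a < p")
    case True
    then show ?thesis using a \<open>a \<noteq> 0\<close> by blast
  next
    case False
    have "2 * (p - a) < p" using False \<open>odd p\<close> \<open>a < p\<close> by presburger
    moreover have "[int (p - a) * int r = -1] (mod int p)"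
    proof -
      have "int (p - a) * int r = int p * int r - int a * int r"
        using \<open>a < p\<close> by (simp add: of_nat_diff algebra_simps)
      moreover have "[int p * int r - int a * int r = 0 - 1] (mod int p)"
        by (intro cong_diff a) (simp add: cong_0_iff)
      ultimately show ?thesis by simp
    qed
    ultimately show ?thesis using \<open>a < p\<close>
      by (intro exI[of _ "p - a"] exI[of _ "-1"]) simp
  qed
qed

lemma exists_complement:
  fixes p r A :: nat and e :: int
  assumes "0 < A" "A < p" "1 < r" "e \<in> {1, -1}" "[int A * int r = e] (mod int p)"
  shows "\<exists>P. int A * int r + P * int p = e + int p * int r \<and> 0 < P \<and> P < int r"
proof -
  obtain t where t: "int A * int r - e = int p * t"
    using assms(5) by (auto simp: cong_iff_dvd_diff)
  have "1 * int r \<le> int A * int r" "int A * int r \<le> (int p - 1) * int r"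
    using assms by (auto intro!: mult_right_mono)
  \<comment> \<open>Two units of room keep \<open>A * r - e\<close> strictly between
    \<open>0\<close> and \<open>p * r\<close> for either sign.\<close>
  moreover have "2 \<le> int r" using assms(3) by simp
  ultimately have "2 \<le> int A * int r" "int A * int r \<le> int p * int r - 2"
    by (simp_all only: left_diff_distrib mult_1)
  then have "0 < int p * t" "int p * t < int p * int r"
    using assms(4) t by auto
  then have "0 < t" "t < int r"
    using assms by (simp_all add: zero_less_mult_iff mult_less_cancel_left_pos)
  then show ?thesis
    using t by (intro exI[of _ "int r - t"]) (simp add: algebra_simps)
qed

lemma exists_ternary_bezout:
  fixes p q r :: nat
  assumes "coprime p q" "coprime p r" "coprime q r"
  shows "\<exists>x y z. x * (int q * int r) + y * (int r * int p) + z * (int p * int q) = 1"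
proof -
  have "gcd (int q * int r) (int p) = 1" "gcd (int r) (int q) = 1"
    using assms by (simp_all add: coprime_commute flip: coprime_iff_gcd_eq_1)
  then obtain u v s t where "u * (int q * int r) + v * int p = 1" "s * int r + t * int q = 1"
    using bezout_int by metis
  then have "u * (int q * int r) + v * int p * (s * int r + t * int q) = 1" by simp
  then have "u * (int q * int r) + (v * s) * (int r * int p) + (v * t) * (int p * int q) = 1"
    by (simp add: algebra_simps)
  then show ?thesis by blast
qed

lemma coeff_cyclotomic_pqr_bounds:
  fixes p q r A n :: nat and e :: int
  assumes primes: "prime p" "prime q" "prime r" and less: "odd p" "p < q" "q < r"
    and A: "0 < A" "2 * A < p" "e \<in> {1, -1}" "[int A * int q = e] (mod int p)"
    and n: "n < p * q * r"
  shows "\<exists>S::int. coeff (cyclotomic (p * q * r)) n = of_int S \<and> \<bar>S\<bar> \<le> int p - int A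
    \<and> 2 * \<bar>S\<bar> \<le> int p + 2 * int A \<and> (p \<in> {3, 5, 7, 11, 13, 19} \<longrightarrow> 3 * \<bar>S\<bar> \<le> 2 * int p)"
proof -
  have ne: "p \<noteq> q" "p \<noteq> r" "q \<noteq> r" using less by auto
  have gt: "1 < p" "1 < q" "1 < r" using primes prime_gt_1_nat by blast+
  have p3: "3 \<le> p" using gt(1) less(1) by presburger
  obtain x y z where "x * (int q * int r) + y * (int r * int p) + z * (int p * int q) = 1"
    using exists_ternary_bezout primes ne by (metis primes_coprime)
  then interpret ternary_residues p q r x y z
    using primes ne by unfold_locales auto
  have "\<not> p dvd r" using primes ne primes_dvd_imp_eq by blast
  then obtain A1 e1 where A1: "0 < A1" "2 * A1 < p" "e1 \<in> {1, -1}" "[int A1 * int r = e1] (mod int p)"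
    using exists_signed_inverse[OF primes(1) less(1)] by blast
  obtain P where P: "int A1 * int r + P * int p = e1 + int p * int r" "0 < P" "P < int r"
    using exists_complement[of A1 p r e1] A1 gt by auto
  obtain Q where Q: "int A * int q + Q * int p = e + int p * int q" "0 < Q" "Q < int q"
    using exists_complement[of A p q e] A gt by auto
  \<comment> \<open>A negative sign moves the window by \<open>q\<close> or \<open>r\<close>; the
    signed difference there agrees with the original one up to the factor
    \<open>e1 * e\<close>.\<close>
  define k1 where "k1 = int n - (if e1 = 1 then 0 else int q) - (if e = 1 then 0 else int r)"
  define S where "S = (\<Sum>i<p. signed_diff e1 e (k1 - int i))"
  have "int n < int (p * q * r)" using n by (simp only: of_nat_less_iff)
  then have k1: "k1 < int p * int q * int r" "k1 - e1 * int q < int p * int q * int r"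
      "k1 - e * int r < int p * int q * int r" "k1 - e1 * int q - e * int r < int p * int q * int r"
    using A A1 by (auto simp: k1_def)
  note b = window_bounds[OF P(1) A1(1,2) P(2,3) Q(1) A(1,2) Q(2,3) A1(3) A(3) p3 less(2) k1, folded S_def]
  have "coeff (cyclotomic (p * q * r)) n = of_int (e1 * e * S)"
  proof -
    have "(\<Sum>i<p. let k = int n - int i in
      chi p q r k - chi p q r (k - int q) - chi p q r (k - int r) + chi p q r (k - int q - int r)) = e1 * e * S"
      unfolding S_def sum_distrib_left Let_def
    proof (rule sum.cong[OF refl])
      fix i
      show "chi p q r (int n - int i) - chi p q r (int n - int i - int q) - chi p q r (int n - int i - int r)
         + chi p q r (int n - int i - int q - int r) = e1 * e * signed_diff e1 e (k1 - int i)"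
        using A A1 by (auto simp: signed_diff_def k1_def algebra_simps)
    qed
    then show ?thesis
      using coeff_cyclotomic_pqr[OF primes ne n] by simp
  qed
  moreover have "\<bar>e1 * e * S\<bar> = \<bar>S\<bar>" using A A1 by auto
  ultimately show ?thesis using b by (intro exI[of _ "e1 * e * S"]) simp
qed

lemma height_pqr_bounds:
  fixes p q r A :: nat and e :: int
  assumes primes: "prime p" "prime q" "prime r" and less: "odd p" "p < q" "q < r"
    and A: "0 < A" "2 * A < p" "e \<in> {1, -1}" "[int A * int q = e] (mod int p)"
  shows "\<exists>s::int. height (p * q * r) = of_int s \<and> 0 \<le> s \<and> s \<le> int p - int A
    \<and> 2 * s \<le> int p + 2 * int A \<and> (p \<in> {3, 5, 7, 11, 13, 19} \<longrightarrow> 3 * s \<le> 2 * int p)"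
proof -
  let ?I = "(\<lambda>k. norm (coeff (cyclotomic (p * q * r)) k)) ` {0..totient (p * q * r)}"
  have "height (p * q * r) \<in> ?I"
    unfolding height_def by (intro Max_in) auto
  then obtain k where k: "k \<le> totient (p * q * r)" "height (p * q * r) = norm (coeff (cyclotomic (p * q * r)) k)"
    by auto
  have "1 < p * q * r"
    using primes prime_gt_1_nat by (metis less_1_mult)
  then have "k < p * q * r" using k(1) totient_less[of "p * q * r"] by simp
  then obtain S :: int where S: "coeff (cyclotomic (p * q * r)) k = of_int S" "\<bar>S\<bar> \<le> int p - int A"
    "2 * \<bar>S\<bar> \<le> int p + 2 * int A" "p \<in> {3, 5, 7, 11, 13, 19} \<longrightarrow> 3 * \<bar>S\<bar> \<le> 2 * int p"
    using coeff_cyclotomic_pqr_bounds[OF assms] by blast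
  then show ?thesis
    using k(2) by (intro exI[of _ "\<bar>S\<bar>"]) simp
qed

lemma norm_coeff_le_height:
  assumes "coeff (cyclotomic n) k \<noteq> 0"
  shows "norm (coeff (cyclotomic n) k) \<le> height n"
proof -
  have "k \<le> totient n" using assms le_degree degree_cyclotomic by metis
  then show ?thesis unfolding height_def by (intro Max_ge) auto
qed

text \<open>Boundedness and integrality leave finitely many values, so \<open>Greatest\<close>
  denotes an attained maximum.\<close>

lemma Greatest_bounded_int:
  fixes P :: "real \<Rightarrow> bool"
  assumes "\<And>h. P h \<Longrightarrow> \<exists>s::int. h = of_int s \<and> 0 \<le> s \<and> s \<le> b" and "P h0"
  shows "P (Greatest P)" "\<And>h. P h \<Longrightarrow> h \<le> Greatest P"
proof -
  have "{h. P h} \<subseteq> real_of_int ` {0..b}" using assms(1) by fastforce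
  then have fin: "finite {h. P h}" by (rule finite_subset) simp
  have Max: "P (Max {h. P h})" "\<And>h. P h \<Longrightarrow> h \<le> Max {h. P h}"
    using Max_in[OF fin] Max_ge[OF fin] assms(2) by auto
  then have "Greatest P = Max {h. P h}" by (intro Greatest_equality) auto
  then show "P (Greatest P)" "\<And>h. P h \<Longrightarrow> h \<le> Greatest P" using Max by simp_all
qed

lemma max_height_bounds:
  fixes p q A :: nat and e :: int
  assumes "prime p" "prime q" "odd p" "p < q"
    and A: "0 < A" "2 * A < p" "e \<in> {1, -1}" "[int A * int q = e] (mod int p)"
  shows "\<exists>s::int. max_height p q = of_int s \<and> 0 \<le> s \<and> s \<le> int p - int A
      \<and> 2 * s \<le> int p + 2 * int A \<and> (p \<in> {3, 5, 7, 11, 13, 19} \<longrightarrow> 3 * s \<le> 2 * int p)" (is ?bound)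
    and "\<And>r. prime r \<Longrightarrow> q < r \<Longrightarrow> height (p * q * r) \<le> max_height p q"
proof -
  define P where "P = (\<lambda>h. \<exists>r. prime r \<and> r > q \<and> h = height (p * q * r))"
  have eq: "max_height p q = Greatest P" unfolding max_height_def P_def ..
  have b: "\<exists>s::int. h = of_int s \<and> 0 \<le> s \<and> s \<le> int p - int A
      \<and> 2 * s \<le> int p + 2 * int A \<and> (p \<in> {3, 5, 7, 11, 13, 19} \<longrightarrow> 3 * s \<le> 2 * int p)" if "P h" for h
    using that height_pqr_bounds[OF assms(1,2) _ assms(3,4) _ A] unfolding P_def by blast
  obtain r0 where "prime r0" "q < r0" using bigger_prime by blast
  then have "P (height (p * q * r0))" unfolding P_def by blast
  then have G: "P (Greatest P)" "\<And>h. P h \<Longrightarrow> h \<le> Greatest P"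
    using Greatest_bounded_int[of P "int p - int A"] b by blast+
  show ?bound using b[OF G(1)] unfolding eq .
  show "height (p * q * r) \<le> max_height p q" if "prime r" "q < r" for r
    using G(2) that unfolding eq P_def by blast
qed

text \<open>The prime \<open>q0\<close> makes the residue class inhabited; the explicit witnesses
  supply it later.\<close>

lemma max_height_class_bounds:
  fixes p \<beta> A q0 :: nat and e :: int
  assumes "prime p" "odd p" and q0: "prime q0" "p < q0" "[q0 = \<beta>] (mod p)"
    and A: "0 < A" "2 * A < p" "e \<in> {1, -1}" "[int A * int \<beta> = e] (mod int p)"
  shows "\<exists>s::int. max_height_class p \<beta> = of_int s \<and> 0 \<le> s \<and> s \<le> int p - int A
      \<and> 2 * s \<le> int p + 2 * int A \<and> (p \<in> {3, 5, 7, 11, 13, 19} \<longrightarrow> 3 * s \<le> 2 * int p)" (is ?bound)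
    and "\<And>q r. prime q \<Longrightarrow> prime r \<Longrightarrow> p < q \<Longrightarrow> q < r \<Longrightarrow> [q = \<beta>] (mod p) \<Longrightarrow>
      height (p * q * r) \<le> max_height_class p \<beta>"
proof -
  define P where "P = (\<lambda>h. \<exists>q. prime q \<and> q > p \<and> [q = \<beta>] (mod p) \<and> h = max_height p q)"
  have eq: "max_height_class p \<beta> = Greatest P" unfolding max_height_class_def P_def ..
  have cong: "[int A * int q = e] (mod int p)" if "[q = \<beta>] (mod p)" for q
  proof -
    have "[int q = int \<beta>] (mod int p)" using that by (simp add: cong_int_iff)
    then have "[int A * int q = int A * int \<beta>] (mod int p)" by (intro cong_mult cong_refl)
    then show ?thesis using A(4) cong_trans by blast
  qed
  have b: "\<exists>s::int. h = of_int s \<and> 0 \<le> s \<and> s \<le> int p - int A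
      \<and> 2 * s \<le> int p + 2 * int A \<and> (p \<in> {3, 5, 7, 11, 13, 19} \<longrightarrow> 3 * s \<le> 2 * int p)" if Ph: "P h" for h
  proof -
    obtain q where q: "prime q" "p < q" "[q = \<beta>] (mod p)" "h = max_height p q"
      using Ph unfolding P_def by blast
    show ?thesis
      unfolding q(4) using max_height_bounds(1)[OF assms(1) q(1) assms(2) q(2) A(1-3) cong[OF q(3)]] .
  qed
  have "P (max_height p q0)" unfolding P_def using q0 by blast
  then have G: "P (Greatest P)" "\<And>h. P h \<Longrightarrow> h \<le> Greatest P"
    using Greatest_bounded_int[of P "int p - int A"] b by blast+
  show ?bound using b[OF G(1)] unfolding eq .
  show "height (p * q * r) \<le> max_height_class p \<beta>"
    if h: "prime q" "prime r" "p < q" "q < r" "[q = \<beta>] (mod p)" for q r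
  proof -
    have "height (p * q * r) \<le> max_height p q"
      using max_height_bounds(2)[OF assms(1) h(1) assms(2) h(3) A(1-3) cong[OF h(5)] h(2,4)] .
    also have "\<dots> \<le> max_height_class p \<beta>"
      unfolding eq using G(2) h P_def by blast
    finally show ?thesis .
  qed
qed

text \<open>\<open>A\<close> is the smaller of \<open>\<beta>'\<close> and
  \<open>p - \<beta>'\<close>. The bounds \<open>p - A\<close> and \<open>p / 2 + A\<close> cross at
  \<open>A = p / 4\<close>, where \<open>w_low\<close> switches between them.\<close>

lemma max_height_class_le_m:
  fixes p \<beta> \<beta>' q0 :: nat
  assumes p: "p \<in> {3, 5, 7, 11, 13, 19}" and prime: "prime p"
    and q0: "prime q0" "p < q0" "[q0 = \<beta>] (mod p)"
    and \<beta>': "\<beta>' \<in> {1..p - 1}" "[\<beta> * \<beta>' = 1] (mod p)"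
  shows "max_height_class p \<beta> \<le> real_of_int (m p \<beta>')"
    and "\<And>q r. prime q \<Longrightarrow> prime r \<Longrightarrow> p < q \<Longrightarrow> q < r \<Longrightarrow> [q = \<beta>] (mod p) \<Longrightarrow>
      height (p * q * r) \<le> max_height_class p \<beta>"
proof -
  have odd: "odd p" using p by auto
  define A where "A = (if 2 * \<beta>' < p then \<beta>' else p - \<beta>')"
  define e :: int where "e = (if 2 * \<beta>' < p then 1 else -1)"
  have A: "0 < A" "2 * A < p" "e \<in> {1, -1}"
    using \<beta>'(1) odd unfolding A_def e_def by (auto; presburger)+
  have c: "[int \<beta>' * int \<beta> = 1] (mod int p)"
    using \<beta>'(2) by (metis cong_int_iff mult.commute of_nat_1 of_nat_mult)
  have Ae: "[int A * int \<beta> = e] (mod int p)"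
  proof (cases "2 * \<beta>' < p")
    case True
    then show ?thesis using c by (simp add: A_def e_def)
  next
    case False
    have "\<beta>' \<le> p" using \<beta>'(1) by auto
    then have "int (p - \<beta>') * int \<beta> = int p * int \<beta> - int \<beta>' * int \<beta>"
      by (simp add: of_nat_diff algebra_simps)
    moreover have "[int p * int \<beta> - int \<beta>' * int \<beta> = 0 - 1] (mod int p)"
      by (intro cong_diff c) (simp add: cong_0_iff)
    ultimately show ?thesis using False by (simp add: A_def e_def)
  qed
  note b = max_height_class_bounds[OF prime odd q0 A Ae]
  show "height (p * q * r) \<le> max_height_class p \<beta>"
    if "prime q" "prime r" "p < q" "q < r" "[q = \<beta>] (mod p)" for q r
    using b(2) that by blast
  obtain s :: int where s: "max_height_class p \<beta> = of_int s" "s \<le> int p - int A"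
      "2 * s \<le> int p + 2 * int A" "3 * s \<le> 2 * int p"
    using b(1) p by blast
  have w: "w p \<beta>' = w_low p A"
    using \<beta>'(1) odd unfolding w_def A_def by (auto; presburger)
  have "s \<le> int (w_low p A)"
  proof (cases "real A < real p / 4")
    case True
    \<comment> \<open>Oddness of \<open>p\<close> rounds \<open>p / 2 + A\<close> down to
      \<open>(p - 1) div 2 + A\<close>.\<close>
    then show ?thesis using s(3) odd by (auto simp: w_low_def elim!: oddE)
  next
    case False
    then show ?thesis using s(2) A by (simp add: w_low_def of_nat_diff)
  qed
  moreover have "s \<le> \<lfloor>2 / 3 * real p\<rfloor>"
    using s(4) by (simp add: le_floor_iff)
  ultimately show "max_height_class p \<beta> \<le> real_of_int (m p \<beta>')"
    unfolding s(1) m_def w by simp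
qed

section \<open>Explicit coefficients\<close>

text \<open>Trial division up to \<open>71\<close> decides primality below
  \<open>72 * 72 = 5184\<close>, which covers all primes in the witness rows.\<close>

definition prime_check :: "int \<Rightarrow> bool" where
  "prime_check n \<longleftrightarrow> 1 < n \<and> n < 5184 \<and> (\<forall>d\<in>set [2..71]. n \<le> d \<or> n mod d \<noteq> 0)"

lemma prime_check_sound:
  assumes "prime_check n"
  shows "prime (nat n)"
proof (rule ccontr)
  assume "\<not> prime (nat n)"
  define k where "k = nat n"
  note check = assms[unfolded prime_check_def]
  have n: "n = int k" "1 < k" "k < 5184"
    using check[THEN conjunct1] check[THEN conjunct2, THEN conjunct1] unfolding k_def by linarith+
  obtain a where a: "a dvd k" "a \<noteq> 1" "a \<noteq> k"
    using \<open>\<not> prime (nat n)\<close> n unfolding k_def[symmetric] prime_nat_iff by blast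
  then obtain b where b: "k = a * b" by blast
  have ab: "k = a * b" "1 < a" "1 < b"
    using a b n(2) by (cases a; cases b; force)+
  have "\<exists>d. 2 \<le> d \<and> d \<le> 71 \<and> d < k \<and> d dvd k"
  proof (cases "a \<le> 71")
    case True
    then show ?thesis using ab by (intro exI[of _ a]) auto
  next
    case False
    have "b \<le> 71"
    proof (rule ccontr)
      assume "\<not> b \<le> 71"
      then have "72 * 72 \<le> a * b" using False by (intro mult_le_mono) auto
      then show False using ab n by simp
    qed
    then show ?thesis using ab by (intro exI[of _ b]) auto
  qed
  then obtain d where d: "2 \<le> d" "d \<le> 71" "d < k" "d dvd k" by blast
  then have "2 \<le> int d \<and> int d \<le> 71" "\<not> n \<le> int d" "n mod int d = 0"
    using n(1) by (auto simp: mod_eq_0_iff_dvd)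
  then show False
    using check[THEN conjunct2, THEN conjunct2, rule_format, of "int d"] unfolding set_upto atLeastAtMost_iff by linarith
qed

text \<open>An evaluable window sum: the sum of quotients is the negated \<open>carry\<close>, so
  representability is tested without a search for digits.\<close>

definition num_coeff :: "int \<Rightarrow> int \<Rightarrow> int \<Rightarrow> int \<Rightarrow> int \<Rightarrow> int \<Rightarrow> int \<Rightarrow> int" where
  "num_coeff p q r x y z n = (let chi = (\<lambda>k. if k * x div p + k * y div q + k * z div r = 0 then 1 else 0) in
     \<Sum>k\<leftarrow>[n - p + 1..n]. chi k - chi (k - q) - chi (k - r) + chi (k - q - r))"

lemma (in ternary_residues) num_coeff_correct:
  assumes "n < p * q * r"
  shows "coeff (cyclotomic (p * q * r)) n = of_int (num_coeff (int p) (int q) (int r) x y z (int n))"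
proof -
  have chi: "(if k * x div int p + k * y div int q + k * z div int r = 0 then 1 else 0) = chi p q r k" for k
    by (simp add: chi_def represented_iff carry_def)
  let ?g = "\<lambda>k. chi p q r k - chi p q r (k - int q) - chi p q r (k - int r) + chi p q r (k - int q - int r)"
  have "num_coeff (int p) (int q) (int r) x y z (int n) = (\<Sum>k\<in>{int n - int p + 1..int n}. ?g k)"
    unfolding num_coeff_def Let_def chi by (subst sum_list_distinct_conv_sum_set) simp_all
  also have "\<dots> = (\<Sum>i<p. ?g (int n - int i))"
    by (rule sum.reindex_bij_witness[of _ "\<lambda>i. int n - int i" "\<lambda>k. nat (int n - k)"]) auto
  finally show ?thesis
    using coeff_cyclotomic_pqr[OF primes ne assms] by (simp add: Let_def)
qed

text \<open>
  Rows \<open>(p, \<beta>, v, q, r, n, x, y, z)\<close>, found by a computer search, such that the \<open>n\<close>-th coefficient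
  has absolute value at least \<open>v\<close>; \<open>x, y, z\<close> are Bezout coefficients for \<open>q r, r p, p q\<close>.
\<close>
definition witnesses :: "(int \<times> int \<times> int \<times> int \<times> int \<times> int \<times> int \<times> int \<times> int) list" where
  "witnesses =
    [(3, 1, 2, 7, 13, 21, 1, 2, -8),
     (5, 1, 3, 11, 17, 292, 3, 7, -21),
     (5, 2, 3, 7, 11, 119, 3, 6, -16),
     (7, 1, 4, 29, 79, 5767, 4, 15, -86),
     (7, 2, 4, 23, 31, 1523, 6, 7, -36),
     (7, 3, 4, 17, 23, 875, 6, 15, -40),
     (11, 1, 6, 89, 607, 243407, 6, 45, -638),
     (11, 2, 6, 13, 71, 3780, 10, 1, -70),
     (11, 3, 7, 113, 1481, 518466, 10, 6, -1425),
     (11, 4, 7, 59, 421, 84259, 1, 57, -445),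
     (11, 5, 6, 71, 163, 56308, 1, 4, -24),
     (13, 1, 7, 79, 1987, 916096, 6, 39, -1898),
     (13, 2, 7, 67, 79, 30887, 7, 64, -118),
     (13, 3, 7, 29, 199, 30248, 12, 5, -218),
     (13, 4, 8, 199, 251, 249745, 9, 131, -339),
     (13, 5, 8, 31, 1097, 137160, 12, 1, -1048),
     (13, 6, 7, 71, 557, 179982, 1, 70, -592),
     (19, 1, 10, 229, 1579, 3134315, 10, 115, -1624),
     (19, 2, 10, 59, 283, 139247, 14, 37, -386),
     (19, 3, 10, 79, 2339, 1546095, 16, 68, -3983),
     (19, 4, 12, 61, 5039, 2156771, 6, 21, -3326),
     (19, 5, 11, 233, 487, 756805, 13, 153, -653),
     (19, 6, 9, 139, 3347, 2580551, 18, 2, -3219),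
     (19, 7, 11, 83, 1759, 911174, 1, 80, -1788),
     (19, 8, 11, 293, 311, 547347, 18, 6, -301),
     (19, 9, 10, 313, 1009, 2766687, 18, 309, -1952)]"

definition witness_check :: "int \<times> int \<times> int \<times> int \<times> int \<times> int \<times> int \<times> int \<times> int \<Rightarrow> bool" where
  "witness_check = (\<lambda>(p, \<beta>, v, q, r, n, x, y, z).
     prime_check p \<and> prime_check q \<and> prime_check r \<and> p < q \<and> q < r \<and> q mod p = \<beta> \<and>
     x * (q * r) + y * (r * p) + z * (p * q) = 1 \<and> 0 \<le> n \<and> n < p * q * r \<and>
     0 < v \<and> v \<le> \<bar>num_coeff p q r x y z n\<bar>)"

lemma witnesses_checked: "\<forall>w\<in>set witnesses. witness_check w"
  by code_simp

lemma table_witnesses: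
  "\<forall>p\<in>set [3, 5, 7, 11, 13, 19]. \<forall>\<beta>\<in>set [1..<(p - 1) div 2 + 1].
     \<exists>(p', \<beta>', v', _)\<in>set witnesses. p' = int p \<and> \<beta>' = int \<beta> \<and> v' = int (v p \<beta>)"
  by code_simp

text \<open>A version of \<open>m\<close> free of real numbers, for evaluation.\<close>

definition m_nat :: "nat \<Rightarrow> nat \<Rightarrow> nat" where
  "m_nat p j = (let i = (if 2 * j < p then j else p - j) in
     min (if 4 * i < p then (p - 1) div 2 + i else p - i) (2 * p div 3))"

lemma m_eq_m_nat:
  assumes "odd p" "j < p"
  shows "m p j = int (m_nat p j)"
proof -
  have "\<lfloor>2 / 3 * real p\<rfloor> = int (2 * p div 3)"
    using floor_divide_of_nat_eq[of "2 * p" 3] by (simp add: of_nat_div)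
  moreover have "w p j = w_low p (if 2 * j < p then j else p - j)"
    using assms unfolding w_def by (auto; presburger)
  moreover have "w_low p i = (if 4 * i < p then (p - 1) div 2 + i else p - i)" for i
    unfolding w_low_def by (simp add: less_divide_eq)
  ultimately show ?thesis unfolding m_def m_nat_def Let_def by (simp only: of_nat_min)
qed

text \<open>For marked entries the general upper bound does not exceed the value attained by the
  witness, so the two bounds coincide.\<close>

lemma boldface_m_nat:
  "\<forall>p\<in>set [3, 5, 7, 11, 13, 19]. \<forall>\<beta>\<in>set [1..<(p - 1) div 2 + 1]. boldface p \<beta> \<longrightarrow>
     (\<forall>\<beta>'\<in>set [1..<p]. (\<beta> * \<beta>') mod p = 1 \<longrightarrow> m_nat p \<beta>' \<le> v p \<beta>)"
  by code_simp

lemma exists_witness: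
  fixes p \<beta> :: nat
  assumes "p \<in> {3, 5, 7, 11, 13, 19}" and "1 \<le> \<beta>" and "\<beta> \<le> (p - 1) div 2"
  shows "\<exists>q r. prime p \<and> prime q \<and> prime r \<and> p < q \<and> q < r \<and> [q = \<beta>] (mod p) \<and>
    real (v p \<beta>) \<le> height (p * q * r)"
proof -
  have "p \<in> set [3, 5, 7, 11, 13, 19]" using assms(1) by simp
  moreover have "\<beta> \<in> set [1..<(p - 1) div 2 + 1]"
    using assms(2,3) unfolding set_upt atLeastLessThan_iff by (intro conjI) linarith+
  ultimately have "\<exists>(p', \<beta>', v', _)\<in>set witnesses. p' = int p \<and> \<beta>' = int \<beta> \<and> v' = int (v p \<beta>)"
    using table_witnesses by blast
  then obtain t where t: "t \<in> set witnesses"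
      "case t of (p', \<beta>', v', _) \<Rightarrow> p' = int p \<and> \<beta>' = int \<beta> \<and> v' = int (v p \<beta>)"
    by (elim bexE) (rule that)
  obtain p' \<beta>' v' q r n x y z where "t = (p', \<beta>', v', q, r, n, x, y, z)"
    by (metis surj_pair)
  then have mem: "(int p, int \<beta>, int (v p \<beta>), q, r, n, x, y, z) \<in> set witnesses"
    using t by simp
  have c: "prime_check (int p)" "prime_check q" "prime_check r" "int p < q" "q < r" "q mod int p = int \<beta>"
     "x * (q * r) + y * (r * int p) + z * (int p * q) = 1" "0 \<le> n" "n < int p * q * r"
     "0 < int (v p \<beta>)" "int (v p \<beta>) \<le> \<bar>num_coeff (int p) q r x y z n\<bar>"
    using bspec[OF witnesses_checked mem] by (simp_all only: witness_check_def split_conv)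
  define q' r' n' where "q' = nat q" and "r' = nat r" and "n' = nat n"
  have eq: "q = int q'" "r = int r'" "n = int n'"
    using c(4,5,8) by (simp_all add: q'_def r'_def n'_def)
  have primes: "prime p" "prime q'" "prime r'"
    using c(1-3)[THEN prime_check_sound] by (simp_all add: q'_def r'_def)
  have less: "p < q'" "q' < r'" using c(4,5) by (simp_all add: eq)
  interpret ternary_residues p q' r' x y z
    using primes less c(7) by unfold_locales (auto simp: eq)
  have "int n' < int (p * q' * r')" using c(9) by (simp add: eq)
  then have "n' < p * q' * r'" by (simp only: of_nat_less_iff)
  note coeff = num_coeff_correct[OF this]
  let ?c = "num_coeff (int p) (int q') (int r') x y z (int n')"
  have "norm (coeff (cyclotomic (p * q' * r')) n') = real_of_int \<bar>?c\<bar>"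
    unfolding coeff by simp
  moreover have "?c \<noteq> 0" using c(10,11) unfolding eq by auto
  then have "coeff (cyclotomic (p * q' * r')) n' \<noteq> 0" unfolding coeff by simp
  ultimately have "real_of_int \<bar>?c\<bar> \<le> height (p * q' * r')"
    using norm_coeff_le_height by metis
  moreover have "real_of_int (int (v p \<beta>)) \<le> real_of_int \<bar>?c\<bar>"
    using c(11) unfolding eq of_int_le_iff .
  ultimately have "real (v p \<beta>) \<le> height (p * q' * r')" by simp
  moreover have "[q' = \<beta>] (mod p)"
  proof -
    have "int (q' mod p) = int \<beta>" using c(6) by (simp add: eq zmod_int)
    then have "q' mod p = \<beta>" by (simp only: of_nat_eq_iff)
    then show ?thesis by (metis cong_def mod_mod_trivial)
  qed
  ultimately show ?thesis using primes less by blast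
qed

theorem theorem1p8:
  fixes p \<beta> \<beta>' :: nat
  assumes "p \<in> {3, 5, 7, 11, 13, 19}"
    and "1 \<le> \<beta>" and "\<beta> \<le> (p - 1) div 2"
    and "\<beta>' \<in> {1..p - 1}" and "[\<beta> * \<beta>' = 1] (mod p)"
  shows "real (v p \<beta>) \<le> max_height_class p \<beta>
    \<and> max_height_class p \<beta> \<le> real_of_int (m p \<beta>')
    \<and> (boldface p \<beta> \<longrightarrow> max_height_class p \<beta> = real (v p \<beta>))"
proof -
  obtain q r where qr: "prime p" "prime q" "prime r" "p < q" "q < r" "[q = \<beta>] (mod p)"
    and v: "real (v p \<beta>) \<le> height (p * q * r)"
    using exists_witness[OF assms(1-3)] by blast
  note upper = max_height_class_le_m[OF assms(1) qr(1,2,4,6) assms(4,5)]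
  have lower: "real (v p \<beta>) \<le> max_height_class p \<beta>"
    using v upper(2)[OF qr(2-6)] by simp
  have "real_of_int (m p \<beta>') \<le> real (v p \<beta>)" if "boldface p \<beta>"
  proof -
    have "odd p" "\<beta>' < p" "1 < p" using assms(1,4) by auto
    have "p \<in> set [3, 5, 7, 11, 13, 19]" using assms(1) by simp
    moreover have "\<beta> \<in> set [1..<(p - 1) div 2 + 1]"
      using assms(2,3) unfolding set_upt atLeastLessThan_iff by (intro conjI) linarith+
    moreover have "\<beta>' \<in> set [1..<p]" using assms(4) \<open>\<beta>' < p\<close> by simp
    moreover have "(\<beta> * \<beta>') mod p = 1" using assms(5) \<open>1 < p\<close> by (simp add: cong_def)
    ultimately have "m_nat p \<beta>' \<le> v p \<beta>" using boldface_m_nat that by blast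
    then show ?thesis using m_eq_m_nat[OF \<open>odd p\<close> \<open>\<beta>' < p\<close>] by simp
  qed
  then show ?thesis using lower upper(1) by fastforce
qed

end
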